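(* If a formula $\Phi(x)$ satisfies $\mathbf{D1}$ and $\mathbf{B}_2^U$, then it satisfies $\Sigma_1\text{-}\mathbf{C}^U$; that is, for every $\Sigma_1$ formula $\varphi(\vec x)$, $S\vdash\forall\vec x\,(\varphi(\vec x)\to\Phi(\ulcorner\varphi(\vec{\dot x})\urcorner))$.
   Context: $\mathcal{L}_A$ is the language of first-order arithmetic containing $0,\mathsf{s},+,\times$ (and possibly function symbols for some primitive recursive functions); numerals are $\overline{n}=\mathsf{s}(\cdots\mathsf{s}(0)\cdots)$ ($n$ times). $\mathsf{PA}$ is Peano Arithmetic. $S$ and $T$ are recursively axiomatized consistent extensions of $\mathsf{PA}$ in $\mathcal{L}_A$, and $T$ extends $S$. A natural Gödel numbering is fixed; $\ulcorner\varphi\urcorner$ is the numeral of the Gödel number of $\varphi$, and for a formula $\varphi(\vec x)$, $\ulcorner\varphi(\vec{\dot x})\urcorner$ is a primitive recursive term which, for values $\vec n$ of $\vec x$, gives the Gödel number of $\varphi(\overline{\vec n})$. $\Phi(x)$ is an arbitrary formula with one free variable. Conditions: $\mathbf{D1}$: for every formula $\varphi$, if $T\vdash\varphi$ then $S\vdash\Phi(\ulcorner\varphi\urcorner)$. $\mathbf{B}_2^U$: for all formulas $\varphi(\vec x),\psi(\vec x)$, if $T\vdash\forall\vec x(\varphi(\vec x)\to\psi(\vec x))$ then $S\vdash\forall\vec x(\Phi(\ulcorner\varphi(\vec{\dot x})\urcorner)\to\Phi(\ulcorner\psi(\vec{\dot x})\urcorner))$. *)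

theory Defs
  imports Main "HOL-Library.Nat_Bijection"
begin

section \<open>Primitive recursive function symbols\<close>

text \<open>
  A function symbol is a description of a primitive recursive function. The first argument of
  \<^term>\<open>PRec g h\<close> is the recursion argument: \<open>f(0, xs) = g(xs)\<close> and
  \<open>f(y + 1, xs) = h(y, f(y, xs), xs)\<close>. \<^term>\<open>PComp n g hs\<close> carries its arity \<open>n\<close> because \<open>hs\<close> may be
  empty.
\<close>

datatype pfun =
    PZero nat
  | PSucc
  | PProj nat nat
  | PComp nat pfun "pfun list"
  | PRec pfun pfun

primrec arity :: "pfun \<Rightarrow> nat" where
  "arity (PZero n) = n"
| "arity PSucc = 1"
| "arity (PProj n i) = n"
| "arity (PComp n g hs) = n"
| "arity (PRec g h) = Suc (arity g)"

fun wf_pf :: "pfun \<Rightarrow> bool" where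
  "wf_pf (PZero n) = True"
| "wf_pf PSucc = True"
| "wf_pf (PProj n i) = (i < n)"
| "wf_pf (PComp n g hs) =
     (wf_pf g \<and> length hs = arity g \<and> (\<forall>h\<in>set hs. wf_pf h \<and> arity h = n))"
| "wf_pf (PRec g h) = (wf_pf g \<and> wf_pf h \<and> arity h = arity g + 2)"

fun peval :: "pfun \<Rightarrow> nat list \<Rightarrow> nat" where
  "peval (PZero n) xs = 0"
| "peval PSucc xs = Suc (hd xs)"
| "peval (PProj n i) xs = xs ! i"
| "peval (PComp n g hs) xs = peval g (map (\<lambda>h. peval h xs) hs)"
| "peval (PRec g h) xs =
     rec_nat (peval g (tl xs)) (\<lambda>y r. peval h (y # r # tl xs)) (hd xs)"

fun constituents :: "pfun \<Rightarrow> pfun set" where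
  "constituents (PComp n g hs) = insert g (set hs)"
| "constituents (PRec g h) = {g, h}"
| "constituents _ = {}"


section \<open>Terms and formulas, with de Bruijn indices\<close>

datatype tm =
    Var nat
  | Zero
  | Succ tm
  | Add tm tm
  | Mul tm tm
  | Fn pfun "tm list"

datatype fm =
    Equal tm tm
  | Falsum
  | Conj fm fm
  | Disj fm fm
  | Impl fm fm
  | Forall fm
  | Exists fm

abbreviation Neg :: "fm \<Rightarrow> fm" where
  "Neg \<phi> \<equiv> Impl \<phi> Falsum"

fun numeral_tm :: "nat \<Rightarrow> tm" where
  "numeral_tm 0 = Zero"
| "numeral_tm (Suc n) = Succ (numeral_tm n)"

fun fv_tm :: "tm \<Rightarrow> nat set" where
  "fv_tm (Var i) = {i}"
| "fv_tm Zero = {}"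
| "fv_tm (Succ t) = fv_tm t"
| "fv_tm (Add t u) = fv_tm t \<union> fv_tm u"
| "fv_tm (Mul t u) = fv_tm t \<union> fv_tm u"
| "fv_tm (Fn f ts) = (\<Union>t\<in>set ts. fv_tm t)"

fun fv :: "fm \<Rightarrow> nat set" where
  "fv (Equal t u) = fv_tm t \<union> fv_tm u"
| "fv Falsum = {}"
| "fv (Conj \<phi> \<psi>) = fv \<phi> \<union> fv \<psi>"
| "fv (Disj \<phi> \<psi>) = fv \<phi> \<union> fv \<psi>"
| "fv (Impl \<phi> \<psi>) = fv \<phi> \<union> fv \<psi>"
| "fv (Forall \<phi>) = {i. Suc i \<in> fv \<phi>}"
| "fv (Exists \<phi>) = {i. Suc i \<in> fv \<phi>}"

fun subst_tm :: "(nat \<Rightarrow> tm) \<Rightarrow> tm \<Rightarrow> tm" where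
  "subst_tm \<sigma> (Var i) = \<sigma> i"
| "subst_tm \<sigma> Zero = Zero"
| "subst_tm \<sigma> (Succ t) = Succ (subst_tm \<sigma> t)"
| "subst_tm \<sigma> (Add t u) = Add (subst_tm \<sigma> t) (subst_tm \<sigma> u)"
| "subst_tm \<sigma> (Mul t u) = Mul (subst_tm \<sigma> t) (subst_tm \<sigma> u)"
| "subst_tm \<sigma> (Fn f ts) = Fn f (map (subst_tm \<sigma>) ts)"

definition lift_tm :: "tm \<Rightarrow> tm" where
  "lift_tm = subst_tm (\<lambda>i. Var (Suc i))"

definition up :: "(nat \<Rightarrow> tm) \<Rightarrow> nat \<Rightarrow> tm" where
  "up \<sigma> = case_nat (Var 0) (\<lambda>i. lift_tm (\<sigma> i))"

fun subst :: "(nat \<Rightarrow> tm) \<Rightarrow> fm \<Rightarrow> fm" where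
  "subst \<sigma> (Equal t u) = Equal (subst_tm \<sigma> t) (subst_tm \<sigma> u)"
| "subst \<sigma> Falsum = Falsum"
| "subst \<sigma> (Conj \<phi> \<psi>) = Conj (subst \<sigma> \<phi>) (subst \<sigma> \<psi>)"
| "subst \<sigma> (Disj \<phi> \<psi>) = Disj (subst \<sigma> \<phi>) (subst \<sigma> \<psi>)"
| "subst \<sigma> (Impl \<phi> \<psi>) = Impl (subst \<sigma> \<phi>) (subst \<sigma> \<psi>)"
| "subst \<sigma> (Forall \<phi>) = Forall (subst (up \<sigma>) \<phi>)"
| "subst \<sigma> (Exists \<phi>) = Exists (subst (up \<sigma>) \<phi>)"

definition lift :: "fm \<Rightarrow> fm" where
  "lift = subst (\<lambda>i. Var (Suc i))"

text \<open>\<open>inst \<phi> t\<close> is \<open>\<phi>(t)\<close>, where the distinguished variable of \<open>\<phi>\<close> is the one with index 0.\<close>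

definition inst :: "fm \<Rightarrow> tm \<Rightarrow> fm" where
  "inst \<phi> t = subst (case_nat t Var) \<phi>"

text \<open>\<open>alls n \<phi>\<close> binds the variables with indices below \<open>n\<close>.\<close>

definition alls :: "nat \<Rightarrow> fm \<Rightarrow> fm" where
  "alls n \<phi> = (Forall ^^ n) \<phi>"


section \<open>The language with function symbols \<open>F\<close>, and provability\<close>

text \<open>
  The language consists of \<open>0\<close>, \<open>s\<close>, \<open>+\<close>, \<open>\<times>\<close> and the primitive recursive function symbols in \<open>F\<close>.
\<close>

fun wf_tm :: "pfun set \<Rightarrow> tm \<Rightarrow> bool" where
  "wf_tm F (Var i) = True"
| "wf_tm F Zero = True"
| "wf_tm F (Succ t) = wf_tm F t"
| "wf_tm F (Add t u) = (wf_tm F t \<and> wf_tm F u)"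
| "wf_tm F (Mul t u) = (wf_tm F t \<and> wf_tm F u)"
| "wf_tm F (Fn f ts) = (f \<in> F \<and> length ts = arity f \<and> (\<forall>t\<in>set ts. wf_tm F t))"

fun wf_fm :: "pfun set \<Rightarrow> fm \<Rightarrow> bool" where
  "wf_fm F (Equal t u) = (wf_tm F t \<and> wf_tm F u)"
| "wf_fm F Falsum = True"
| "wf_fm F (Conj \<phi> \<psi>) = (wf_fm F \<phi> \<and> wf_fm F \<psi>)"
| "wf_fm F (Disj \<phi> \<psi>) = (wf_fm F \<phi> \<and> wf_fm F \<psi>)"
| "wf_fm F (Impl \<phi> \<psi>) = (wf_fm F \<phi> \<and> wf_fm F \<psi>)"
| "wf_fm F (Forall \<phi>) = wf_fm F \<phi>"
| "wf_fm F (Exists \<phi>) = wf_fm F \<phi>"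

text \<open>
  Natural deduction for classical first-order logic with equality. The side conditions keep every
  formula of a derivation inside the language.
\<close>

inductive deriv :: "pfun set \<Rightarrow> fm set \<Rightarrow> fm \<Rightarrow> bool" for F where
  Assm: "\<phi> \<in> \<Gamma> \<Longrightarrow> wf_fm F \<phi> \<Longrightarrow> deriv F \<Gamma> \<phi>"
| Classical: "deriv F (insert (Neg \<phi>) \<Gamma>) Falsum \<Longrightarrow> wf_fm F \<phi> \<Longrightarrow> deriv F \<Gamma> \<phi>"
| ConjI: "deriv F \<Gamma> \<phi> \<Longrightarrow> deriv F \<Gamma> \<psi> \<Longrightarrow> deriv F \<Gamma> (Conj \<phi> \<psi>)"
| ConjE1: "deriv F \<Gamma> (Conj \<phi> \<psi>) \<Longrightarrow> deriv F \<Gamma> \<phi>"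
| ConjE2: "deriv F \<Gamma> (Conj \<phi> \<psi>) \<Longrightarrow> deriv F \<Gamma> \<psi>"
| DisjI1: "deriv F \<Gamma> \<phi> \<Longrightarrow> wf_fm F \<psi> \<Longrightarrow> deriv F \<Gamma> (Disj \<phi> \<psi>)"
| DisjI2: "deriv F \<Gamma> \<psi> \<Longrightarrow> wf_fm F \<phi> \<Longrightarrow> deriv F \<Gamma> (Disj \<phi> \<psi>)"
| DisjE: "deriv F \<Gamma> (Disj \<phi> \<psi>) \<Longrightarrow> deriv F (insert \<phi> \<Gamma>) \<chi> \<Longrightarrow> deriv F (insert \<psi> \<Gamma>) \<chi>
    \<Longrightarrow> deriv F \<Gamma> \<chi>"
| ImplI: "deriv F (insert \<phi> \<Gamma>) \<psi> \<Longrightarrow> wf_fm F \<phi> \<Longrightarrow> deriv F \<Gamma> (Impl \<phi> \<psi>)"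
| ImplE: "deriv F \<Gamma> (Impl \<phi> \<psi>) \<Longrightarrow> deriv F \<Gamma> \<phi> \<Longrightarrow> deriv F \<Gamma> \<psi>"
| ForallI: "deriv F (lift ` \<Gamma>) \<phi> \<Longrightarrow> deriv F \<Gamma> (Forall \<phi>)"
| ForallE: "deriv F \<Gamma> (Forall \<phi>) \<Longrightarrow> wf_tm F t \<Longrightarrow> deriv F \<Gamma> (inst \<phi> t)"
| ExistsI: "deriv F \<Gamma> (inst \<phi> t) \<Longrightarrow> wf_tm F t \<Longrightarrow> wf_fm F \<phi> \<Longrightarrow> deriv F \<Gamma> (Exists \<phi>)"
| ExistsE: "deriv F \<Gamma> (Exists \<phi>) \<Longrightarrow> deriv F (insert \<phi> (lift ` \<Gamma>)) (lift \<chi>) \<Longrightarrow> wf_fm F \<chi>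
    \<Longrightarrow> deriv F \<Gamma> \<chi>"
| EqualI: "wf_tm F t \<Longrightarrow> deriv F \<Gamma> (Equal t t)"
| EqualE: "deriv F \<Gamma> (Equal t u) \<Longrightarrow> deriv F \<Gamma> (inst \<phi> t) \<Longrightarrow> wf_fm F \<phi> \<Longrightarrow> deriv F \<Gamma> (inst \<phi> u)"

text \<open>A theory is given by its set of non-logical axioms, which are sentences of the language.\<close>

definition is_theory :: "pfun set \<Rightarrow> fm set \<Rightarrow> bool" where
  "is_theory F T \<longleftrightarrow> (\<forall>\<phi>\<in>T. wf_fm F \<phi> \<and> fv \<phi> = {})"

definition consistent :: "pfun set \<Rightarrow> fm set \<Rightarrow> bool" where
  "consistent F T \<longleftrightarrow> \<not> deriv F T Falsum"

definition extends :: "pfun set \<Rightarrow> fm set \<Rightarrow> fm set \<Rightarrow> bool" where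
  "extends F T S \<longleftrightarrow> (\<forall>\<phi>. deriv F S \<phi> \<longrightarrow> deriv F T \<phi>)"


section \<open>Peano arithmetic\<close>

fun defining_axioms :: "pfun \<Rightarrow> fm set" where
  "defining_axioms (PZero n) =
     {alls n (Equal (Fn (PZero n) (map Var [0..<n])) Zero)}"
| "defining_axioms PSucc =
     {alls 1 (Equal (Fn PSucc [Var 0]) (Succ (Var 0)))}"
| "defining_axioms (PProj n i) =
     {alls n (Equal (Fn (PProj n i) (map Var [0..<n])) (Var i))}"
| "defining_axioms (PComp n g hs) =
     {alls n (Equal (Fn (PComp n g hs) (map Var [0..<n]))
                    (Fn g (map (\<lambda>h. Fn h (map Var [0..<n])) hs)))}"
| "defining_axioms (PRec g h) =
     (let n = arity g; xs = map Var [0..<n]; ys = map Var [1..<Suc n] in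
      {alls n (Equal (Fn (PRec g h) (Zero # xs)) (Fn g xs)),
       alls (Suc n) (Equal (Fn (PRec g h) (Succ (Var 0) # ys))
                           (Fn h (Var 0 # Fn (PRec g h) (Var 0 # ys) # ys)))})"

text \<open>
  In the induction formula the induction variable has index 0; the conclusion of the step
  substitutes its successor for it and leaves the parameters unchanged.
\<close>

definition induction_fm :: "fm \<Rightarrow> fm" where
  "induction_fm \<phi> =
     Impl (inst \<phi> Zero)
       (Impl (Forall (Impl \<phi> (subst (case_nat (Succ (Var 0)) (\<lambda>i. Var (Suc i))) \<phi>)))
         (Forall \<phi>))"

definition PA :: "pfun set \<Rightarrow> fm set" where
  "PA F =
     {alls 1 (Neg (Equal (Succ (Var 0)) Zero)),
      alls 2 (Impl (Equal (Succ (Var 0)) (Succ (Var 1))) (Equal (Var 0) (Var 1))),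
      alls 1 (Equal (Add (Var 0) Zero) (Var 0)),
      alls 2 (Equal (Add (Var 0) (Succ (Var 1))) (Succ (Add (Var 0) (Var 1)))),
      alls 1 (Equal (Mul (Var 0) Zero) Zero),
      alls 2 (Equal (Mul (Var 0) (Succ (Var 1))) (Add (Mul (Var 0) (Var 1)) (Var 0)))}
   \<union> (\<Union>f\<in>F. defining_axioms f)
   \<union> {alls n (induction_fm \<phi>) | n \<phi>. wf_fm F \<phi> \<and> fv (Forall \<phi>) \<subseteq> {..<n}}"


section \<open>Arithmetical hierarchy\<close>

definition leq :: "tm \<Rightarrow> tm \<Rightarrow> fm" where
  "leq t u = Exists (Equal (Add (Var 0) (lift_tm t)) (lift_tm u))"

definition lt :: "tm \<Rightarrow> tm \<Rightarrow> fm" where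
  "lt t u = leq (Succ t) u"

text \<open>
  Since the language has no order symbol, \<open>t \<le> u\<close> and \<open>t < u\<close> are abbreviations, and they count as
  bounded. Lifting the bound \<open>t\<close> expresses that the quantified variable does not occur in it.
\<close>

inductive Delta0 :: "fm \<Rightarrow> bool" where
  "Delta0 (Equal t u)"
| "Delta0 (leq t u)"
| "Delta0 (lt t u)"
| "Delta0 Falsum"
| "Delta0 \<phi> \<Longrightarrow> Delta0 \<psi> \<Longrightarrow> Delta0 (Conj \<phi> \<psi>)"
| "Delta0 \<phi> \<Longrightarrow> Delta0 \<psi> \<Longrightarrow> Delta0 (Disj \<phi> \<psi>)"
| "Delta0 \<phi> \<Longrightarrow> Delta0 \<psi> \<Longrightarrow> Delta0 (Impl \<phi> \<psi>)"
| "Delta0 \<phi> \<Longrightarrow> Delta0 (Forall (Impl (leq (Var 0) (lift_tm t)) \<phi>))"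
| "Delta0 \<phi> \<Longrightarrow> Delta0 (Forall (Impl (lt (Var 0) (lift_tm t)) \<phi>))"
| "Delta0 \<phi> \<Longrightarrow> Delta0 (Exists (Conj (leq (Var 0) (lift_tm t)) \<phi>))"
| "Delta0 \<phi> \<Longrightarrow> Delta0 (Exists (Conj (lt (Var 0) (lift_tm t)) \<phi>))"

inductive Sigma1 :: "fm \<Rightarrow> bool" where
  "Delta0 \<phi> \<Longrightarrow> Sigma1 \<phi>"
| "Sigma1 \<phi> \<Longrightarrow> Sigma1 (Exists \<phi>)"


section \<open>Goedel numbering\<close>

abbreviation pair :: "nat \<Rightarrow> nat \<Rightarrow> nat" where
  "pair m n \<equiv> prod_encode (m, n)"

fun gn_pf :: "pfun \<Rightarrow> nat" where
  "gn_pf (PZero n) = pair 0 n"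
| "gn_pf PSucc = pair 1 0"
| "gn_pf (PProj n i) = pair 2 (pair n i)"
| "gn_pf (PComp n g hs) = pair 3 (pair n (pair (gn_pf g) (list_encode (map gn_pf hs))))"
| "gn_pf (PRec g h) = pair 4 (pair (gn_pf g) (gn_pf h))"

fun gn_tm :: "tm \<Rightarrow> nat" where
  "gn_tm (Var i) = pair 0 i"
| "gn_tm Zero = pair 1 0"
| "gn_tm (Succ t) = pair 2 (gn_tm t)"
| "gn_tm (Add t u) = pair 3 (pair (gn_tm t) (gn_tm u))"
| "gn_tm (Mul t u) = pair 4 (pair (gn_tm t) (gn_tm u))"
| "gn_tm (Fn f ts) = pair 5 (pair (gn_pf f) (list_encode (map gn_tm ts)))"

fun gn :: "fm \<Rightarrow> nat" where
  "gn (Equal t u) = pair 0 (pair (gn_tm t) (gn_tm u))"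
| "gn Falsum = pair 1 0"
| "gn (Conj \<phi> \<psi>) = pair 2 (pair (gn \<phi>) (gn \<psi>))"
| "gn (Disj \<phi> \<psi>) = pair 3 (pair (gn \<phi>) (gn \<psi>))"
| "gn (Impl \<phi> \<psi>) = pair 4 (pair (gn \<phi>) (gn \<psi>))"
| "gn (Forall \<phi>) = pair 5 (gn \<phi>)"
| "gn (Exists \<phi>) = pair 6 (gn \<phi>)"

definition quote :: "fm \<Rightarrow> tm" where
  "quote \<phi> = numeral_tm (gn \<phi>)"


section \<open>Total recursive functions and recursive axiomatizations\<close>

inductive recfn :: "nat \<Rightarrow> (nat list \<Rightarrow> nat) \<Rightarrow> bool" where
  rf_zero: "recfn n (\<lambda>xs. 0)"
| rf_succ: "recfn 1 (\<lambda>xs. Suc (hd xs))"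
| rf_proj: "i < n \<Longrightarrow> recfn n (\<lambda>xs. xs ! i)"
| rf_comp: "recfn (length hs) g \<Longrightarrow> \<forall>h\<in>set hs. recfn n h
    \<Longrightarrow> recfn n (\<lambda>xs. g (map (\<lambda>h. h xs) hs))"
| rf_rec: "recfn n g \<Longrightarrow> recfn (n + 2) h
    \<Longrightarrow> recfn (Suc n) (\<lambda>xs. rec_nat (g (tl xs)) (\<lambda>y r. h (y # r # tl xs)) (hd xs))"
| rf_min: "recfn (Suc n) f \<Longrightarrow> \<forall>xs. length xs = n \<longrightarrow> (\<exists>y. f (y # xs) = 0)
    \<Longrightarrow> recfn n (\<lambda>xs. LEAST y. f (y # xs) = 0)"

definition recursive_set :: "nat set \<Rightarrow> bool" where
  "recursive_set A \<longleftrightarrow> (\<exists>f. recfn 1 f \<and> (\<forall>x. f [x] = (if x \<in> A then 1 else 0)))"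

definition recursively_axiomatized :: "fm set \<Rightarrow> bool" where
  "recursively_axiomatized T \<longleftrightarrow> recursive_set (gn ` T)"


section \<open>Dotted Goedel number terms\<close>

fun const_pf :: "nat \<Rightarrow> nat \<Rightarrow> pfun" where
  "const_pf n 0 = PZero n"
| "const_pf n (Suc k) = PComp n PSucc [const_pf n k]"

definition add_pf :: pfun where
  "add_pf = PRec (PProj 1 0) (PComp 3 PSucc [PProj 3 1])"

definition triangle_pf :: pfun where
  "triangle_pf = PRec (PZero 0) (PComp 2 PSucc [PComp 2 add_pf [PProj 2 0, PProj 2 1]])"

definition pair_pf :: pfun where
  "pair_pf = PComp 2 add_pf [PComp 2 triangle_pf [add_pf], PProj 2 0]"

text \<open>The Goedel number of the numeral of \<open>x\<close>, as a function of \<open>x\<close>.\<close>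

definition num_pf :: pfun where
  "num_pf = PRec (const_pf 0 (gn_tm Zero)) (PComp 2 pair_pf [const_pf 2 2, PProj 2 1])"

abbreviation pair_tm :: "tm \<Rightarrow> tm \<Rightarrow> tm" where
  "pair_tm t u \<equiv> Fn pair_pf [t, u]"

fun list_tm :: "tm list \<Rightarrow> tm" where
  "list_tm [] = Zero"
| "list_tm (t # ts) = Succ (pair_tm t (list_tm ts))"

text \<open>
  \<open>dot_fm 0 \<phi>\<close> is the term \<open>\<ulcorner>\<phi>(\<dots>)\<urcorner>\<close> in which every free variable of \<open>\<phi>\<close> is dotted. The first
  argument of \<open>dot_tm\<close> and \<open>dot_fm\<close> is the number of quantifiers passed: a variable bound by one of
  them is coded as itself, any other variable by the code of the numeral of its value.
\<close>

fun dot_tm :: "nat \<Rightarrow> tm \<Rightarrow> tm" where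
  "dot_tm k (Var i) = (if i < k then numeral_tm (gn_tm (Var i)) else Fn num_pf [Var (i - k)])"
| "dot_tm k Zero = numeral_tm (gn_tm Zero)"
| "dot_tm k (Succ t) = pair_tm (numeral_tm 2) (dot_tm k t)"
| "dot_tm k (Add t u) = pair_tm (numeral_tm 3) (pair_tm (dot_tm k t) (dot_tm k u))"
| "dot_tm k (Mul t u) = pair_tm (numeral_tm 4) (pair_tm (dot_tm k t) (dot_tm k u))"
| "dot_tm k (Fn f ts) =
     pair_tm (numeral_tm 5) (pair_tm (numeral_tm (gn_pf f)) (list_tm (map (dot_tm k) ts)))"

fun dot_fm :: "nat \<Rightarrow> fm \<Rightarrow> tm" where
  "dot_fm k (Equal t u) = pair_tm (numeral_tm 0) (pair_tm (dot_tm k t) (dot_tm k u))"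
| "dot_fm k Falsum = numeral_tm (gn Falsum)"
| "dot_fm k (Conj \<phi> \<psi>) = pair_tm (numeral_tm 2) (pair_tm (dot_fm k \<phi>) (dot_fm k \<psi>))"
| "dot_fm k (Disj \<phi> \<psi>) = pair_tm (numeral_tm 3) (pair_tm (dot_fm k \<phi>) (dot_fm k \<psi>))"
| "dot_fm k (Impl \<phi> \<psi>) = pair_tm (numeral_tm 4) (pair_tm (dot_fm k \<phi>) (dot_fm k \<psi>))"
| "dot_fm k (Forall \<phi>) = pair_tm (numeral_tm 5) (dot_fm (Suc k) \<phi>)"
| "dot_fm k (Exists \<phi>) = pair_tm (numeral_tm 6) (dot_fm (Suc k) \<phi>)"

definition dot_quote :: "fm \<Rightarrow> tm" where
  "dot_quote \<phi> = dot_fm 0 \<phi>"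

text \<open>
  A language is admissible if its function symbols are well-formed, come with the symbols that occur
  in their defining equations, and suffice for the terms \<open>dot_quote \<phi>\<close>.
\<close>

definition admissible :: "pfun set \<Rightarrow> bool" where
  "admissible F \<longleftrightarrow>
     (\<forall>f\<in>F. wf_pf f \<and> constituents f \<subseteq> F) \<and> pair_pf \<in> F \<and> num_pf \<in> F"


section \<open>Derivability conditions\<close>

definition D1 :: "pfun set \<Rightarrow> fm set \<Rightarrow> fm set \<Rightarrow> fm \<Rightarrow> bool" where
  "D1 F S T \<Phi> \<longleftrightarrow> (\<forall>\<phi>. wf_fm F \<phi> \<longrightarrow> deriv F T \<phi> \<longrightarrow> deriv F S (inst \<Phi> (quote \<phi>)))"

definition B2U :: "pfun set \<Rightarrow> fm set \<Rightarrow> fm set \<Rightarrow> fm \<Rightarrow> bool" where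
  "B2U F S T \<Phi> \<longleftrightarrow>
     (\<forall>n \<phi> \<psi>. wf_fm F \<phi> \<longrightarrow> wf_fm F \<psi> \<longrightarrow> fv \<phi> \<subseteq> {..<n} \<longrightarrow> fv \<psi> \<subseteq> {..<n} \<longrightarrow>
        deriv F T (alls n (Impl \<phi> \<psi>)) \<longrightarrow>
        deriv F S (alls n (Impl (inst \<Phi> (dot_quote \<phi>)) (inst \<Phi> (dot_quote \<psi>)))))"

definition Sigma1_CU :: "pfun set \<Rightarrow> fm set \<Rightarrow> fm \<Rightarrow> bool" where
  "Sigma1_CU F S \<Phi> \<longleftrightarrow>
     (\<forall>n \<phi>. wf_fm F \<phi> \<longrightarrow> Sigma1 \<phi> \<longrightarrow> fv \<phi> \<subseteq> {..<n} \<longrightarrow>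
        deriv F S (alls n (Impl \<phi> (inst \<Phi> (dot_quote \<phi>)))))"


section \<open>Adequacy of the coding\<close>

fun eval_tm :: "(nat \<Rightarrow> nat) \<Rightarrow> tm \<Rightarrow> nat" where
  "eval_tm e (Var i) = e i"
| "eval_tm e Zero = 0"
| "eval_tm e (Succ t) = Suc (eval_tm e t)"
| "eval_tm e (Add t u) = eval_tm e t + eval_tm e u"
| "eval_tm e (Mul t u) = eval_tm e t * eval_tm e u"
| "eval_tm e (Fn f ts) = peval f (map (eval_tm e) ts)"

lemma eval_numeral_tm [simp]: "eval_tm e (numeral_tm n) = n"
  by (induction n) auto

lemma subst_numeral_tm [simp]: "subst_tm \<sigma> (numeral_tm n) = numeral_tm n"
  by (induction n) auto

lemma lift_numeral_tm [simp]: "lift_tm (numeral_tm n) = numeral_tm n"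
  by (simp add: lift_tm_def)

lemma peval_const_pf [simp]: "peval (const_pf n k) xs = k"
  by (induction k) auto

lemma peval_add_pf [simp]: "peval add_pf [x, y] = x + y"
  by (induction x) (auto simp: add_pf_def)

lemma peval_triangle_pf [simp]: "peval triangle_pf [x] = triangle x"
  by (induction x) (auto simp: triangle_pf_def)

lemma peval_pair_pf [simp]: "peval pair_pf [x, y] = pair x y"
  by (simp add: pair_pf_def prod_encode_def)

lemma peval_num_pf [simp]: "peval num_pf [x] = gn_tm (numeral_tm x)"
  by (induction x) (auto simp: num_pf_def)

lemma eval_list_tm [simp]: "eval_tm e (list_tm ts) = list_encode (map (eval_tm e) ts)"
  by (induction ts) auto

lemma eval_dot_tm:
  assumes "\<And>i. i < k \<Longrightarrow> \<sigma> i = Var i"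
    and "\<And>i. \<sigma> (i + k) = numeral_tm (e i)"
  shows "eval_tm e (dot_tm k t) = gn_tm (subst_tm \<sigma> t)"
proof (induction t)
  case (Var i)
  show ?case
    using assms(1)[of i] assms(2)[of "i - k"] by (cases "i < k") simp_all
qed (simp_all cong: map_cong)

lemma eval_dot_fm:
  assumes "\<And>i. i < k \<Longrightarrow> \<sigma> i = Var i"
    and "\<And>i. \<sigma> (i + k) = numeral_tm (e i)"
  shows "eval_tm e (dot_fm k \<phi>) = gn (subst \<sigma> \<phi>)"
  using assms
proof (induction \<phi> arbitrary: k \<sigma>)
  case (Equal t u)
  then show ?case by (simp add: eval_dot_tm)
next
  case (Forall \<phi>)
  have "eval_tm e (dot_fm (Suc k) \<phi>) = gn (subst (up \<sigma>) \<phi>)"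
    by (rule Forall.IH) (auto simp: up_def Forall.prems lift_tm_def split: nat.split)
  then show ?case by simp
next
  case (Exists \<phi>)
  have "eval_tm e (dot_fm (Suc k) \<phi>) = gn (subst (up \<sigma>) \<phi>)"
    by (rule Exists.IH) (auto simp: up_def Exists.prems lift_tm_def split: nat.split)
  then show ?case by simp
qed simp_all

theorem eval_dot_quote:
  "eval_tm e (dot_quote \<phi>) = gn (subst (\<lambda>i. numeral_tm (e i)) \<phi>)"
  unfolding dot_quote_def by (rule eval_dot_fm) simp_all

lemma gn_pf_inject: "gn_pf f = gn_pf g \<longleftrightarrow> f = g"
proof (induction f arbitrary: g)
  case (PComp n f hs)
  have "map gn_pf hs = map gn_pf hs' \<longleftrightarrow> hs = hs'" for hs'
    using PComp.IH(2) by (auto intro: list.inj_map_strong)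
  with PComp.IH(1) show ?case by (cases g) (auto simp: list_encode_eq)
next
  case (PZero n)
  show ?case by (cases g) auto
next
  case PSucc
  show ?case by (cases g) auto
next
  case (PProj n i)
  show ?case by (cases g) auto
next
  case (PRec f h)
  then show ?case by (cases g) auto
qed

lemma gn_tm_inject: "gn_tm t = gn_tm u \<longleftrightarrow> t = u"
proof (induction t arbitrary: u)
  case (Fn f ts)
  have "map gn_tm ts = map gn_tm ts' \<longleftrightarrow> ts = ts'" for ts'
    using Fn.IH by (auto intro: list.inj_map_strong)
  then show ?case by (cases u) (auto simp: gn_pf_inject list_encode_eq)
next
  case (Var i)
  show ?case by (cases u) auto
next
  case Zero
  show ?case by (cases u) auto
next
  case (Succ t)
  then show ?case by (cases u) auto
next
  case (Add t t')
  then show ?case by (cases u) auto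
next
  case (Mul t t')
  then show ?case by (cases u) auto
qed

theorem gn_inject: "gn \<phi> = gn \<psi> \<longleftrightarrow> \<phi> = \<psi>"
proof (induction \<phi> arbitrary: \<psi>)
  case (Equal t u)
  show ?case by (cases \<psi>) (auto simp: gn_tm_inject)
next
  case Falsum
  show ?case by (cases \<psi>) auto
next
  case (Conj \<phi>1 \<phi>2)
  then show ?case by (cases \<psi>) auto
next
  case (Disj \<phi>1 \<phi>2)
  then show ?case by (cases \<psi>) auto
next
  case (Impl \<phi>1 \<phi>2)
  then show ?case by (cases \<psi>) auto
next
  case (Forall \<phi>)
  then show ?case by (cases \<psi>) auto
next
  case (Exists \<phi>)
  then show ?case by (cases \<psi>) auto
qed

lemma admissible_all: "admissible {f. wf_pf f}"
proof -
  have "wf_pf (const_pf n k) \<and> arity (const_pf n k) = n" for n k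
    by (induction k) auto
  moreover have "constituents f \<subseteq> {f. wf_pf f}" if "wf_pf f" for f
    using that by (cases f) auto
  ultimately show ?thesis
    by (auto simp: admissible_def num_pf_def pair_pf_def triangle_pf_def add_pf_def)
qed

end

theory Submission
  imports Defs "HOL-Library.Countable_Set"
begin

text \<open>
  By the completeness theorem it suffices to argue in a model \<open>M\<close> of \<open>S\<close>. There \<open>\<Phi>\<close> is a set \<open>P\<close> of
  codes, and \<open>B\<^sub>2\<^sup>U\<close> says that \<open>P\<close> is closed under implications provable in \<open>T\<close>, with nonstandard
  numerals for the variables. Nothing makes \<open>P\<close> closed under conjunction, so the usual induction on
  \<open>\<phi>\<close> is applied to a stronger claim: for every side formula \<open>\<psi>\<close>, if \<open>\<phi>\<close> holds in \<open>M\<close> and \<open>\<psi>\<close> is in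
  \<open>P\<close>, then \<open>\<psi> \<and> \<phi>\<close> is in \<open>P\<close>. This claim is closed under conjunction, disjunction, existential
  and, by induction inside \<open>M\<close>, bounded universal quantification; another induction inside \<open>M\<close>
  evaluates the primitive recursive terms. Negations in \<open>\<Delta>\<^sub>0\<close> formulas are pushed down to
  equations, where they become disjunctions of strict inequalities. Finally \<open>D1\<close> puts a tautology
  into \<open>P\<close>, which serves as the first side formula.
\<close>

section \<open>Substitution and derivations\<close>

text \<open>The code of a formula at elements \<open>e i\<close> of \<open>M\<close> may contain
  nonstandard numerals, so it need not be the code of any actual formula. \<open>B2U\<close>
  therefore speaks only about actual formulas with such elements as parameters. The side formula is
  accordingly an actual formula, quantified outside the model, and every induction inside
  \<open>M\<close> is made for one fixed choice of it. The obstacle at the atomic level is that a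
  dotted code spells a term out symbol by symbol: the code of \<open>x + y\<close> is not the code
  of the numeral of its value. The coincidence of codes to build on is that the numeral of
  \<open>s(a)\<close> is coded as the successor of the numeral of \<open>a\<close>, also for
  nonstandard \<open>a\<close>. Hence a term is first equated, inside \<open>P\<close>, with a
  variable that holds its value, and atomic formulas are then handled through such variables.
  Completeness is used for both theories: for \<open>S\<close> to reach the conclusion, and for
  \<open>T\<close> to replace derivability of an implication by its truth in all models of PA, so
  that derivations in \<open>T\<close> need not be written out.\<close>

lemma subst_tm_subst_tm: "subst_tm \<sigma> (subst_tm \<tau> t) = subst_tm (\<lambda>i. subst_tm \<sigma> (\<tau> i)) t"
  by (induction t) simp_all

lemma subst_tm_cong: "(\<And>i. i \<in> fv_tm t \<Longrightarrow> \<sigma> i = \<tau> i) \<Longrightarrow> subst_tm \<sigma> t = subst_tm \<tau> t"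
  by (induction t) auto

lemma subst_tm_Var [simp]: "subst_tm Var t = t"
  by (induction t) (simp_all add: map_idI)

lemma up_0 [simp]: "up \<sigma> 0 = Var 0"
  and up_Suc [simp]: "up \<sigma> (Suc i) = lift_tm (\<sigma> i)"
  by (simp_all add: up_def)

lemma up_Var [simp]: "up Var = Var"
  by (rule ext) (simp add: up_def lift_tm_def split: nat.split)

lemma subst_Var [simp]: "subst Var \<phi> = \<phi>"
  by (induction \<phi>) simp_all

lemma subst_up_lift_tm: "subst_tm (up \<sigma>) (lift_tm t) = lift_tm (subst_tm \<sigma> t)"
  by (simp add: lift_tm_def subst_tm_subst_tm up_def)

lemma up_subst: "up (\<lambda>i. subst_tm \<sigma> (\<tau> i)) = (\<lambda>i. subst_tm (up \<sigma>) (up \<tau> i))"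
proof
  show "up (\<lambda>i. subst_tm \<sigma> (\<tau> i)) i = subst_tm (up \<sigma>) (up \<tau> i)" for i
    by (cases i) (simp_all add: subst_up_lift_tm)
qed

lemma subst_subst: "subst \<sigma> (subst \<tau> \<phi>) = subst (\<lambda>i. subst_tm \<sigma> (\<tau> i)) \<phi>"
  by (induction \<phi> arbitrary: \<sigma> \<tau>) (simp_all add: subst_tm_subst_tm up_subst)

lemma subst_cong: "(\<And>i. i \<in> fv \<phi> \<Longrightarrow> \<sigma> i = \<tau> i) \<Longrightarrow> subst \<sigma> \<phi> = subst \<tau> \<phi>"
proof (induction \<phi> arbitrary: \<sigma> \<tau>)
  case (Equal t u)
  then show ?case by (auto intro: subst_tm_cong)
next
  case (Forall \<phi>)
  have "subst (up \<sigma>) \<phi> = subst (up \<tau>) \<phi>"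
    by (rule Forall.IH) (auto simp: up_def Forall.prems split: nat.split)
  then show ?case by simp
next
  case (Exists \<phi>)
  have "subst (up \<sigma>) \<phi> = subst (up \<tau>) \<phi>"
    by (rule Exists.IH) (auto simp: up_def Exists.prems split: nat.split)
  then show ?case by simp
next
  case (Conj \<phi> \<psi>)
  have "subst \<sigma> \<phi> = subst \<tau> \<phi>" "subst \<sigma> \<psi> = subst \<tau> \<psi>"
    using Conj.prems by (auto intro!: Conj.IH)
  then show ?case by simp
next
  case (Disj \<phi> \<psi>)
  have "subst \<sigma> \<phi> = subst \<tau> \<phi>" "subst \<sigma> \<psi> = subst \<tau> \<psi>"
    using Disj.prems by (auto intro!: Disj.IH)
  then show ?case by simp
next
  case (Impl \<phi> \<psi>)
  have "subst \<sigma> \<phi> = subst \<tau> \<phi>" "subst \<sigma> \<psi> = subst \<tau> \<psi>"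
    using Impl.prems by (auto intro!: Impl.IH)
  then show ?case by simp
qed simp

lemma subst_lift: "subst (up \<sigma>) (lift \<phi>) = lift (subst \<sigma> \<phi>)"
  by (simp add: lift_def subst_subst lift_tm_def)

lemma subst_inst: "subst \<sigma> (inst \<phi> t) = inst (subst (up \<sigma>) \<phi>) (subst_tm \<sigma> t)"
proof -
  have "(\<lambda>i. subst_tm \<sigma> (case_nat t Var i)) =
      (\<lambda>i. subst_tm (case_nat (subst_tm \<sigma> t) Var) (up \<sigma> i))"
    by (rule ext) (simp add: up_def lift_tm_def subst_tm_subst_tm split: nat.split)
  then show ?thesis by (simp add: inst_def subst_subst)
qed

text \<open>In the term model \<open>case_nat t \<sigma>\<close> plays the extended environment, so
  this identity ties the truth of a quantified formula to its instances.\<close>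

lemma inst_subst_up: "inst (subst (up \<sigma>) \<phi>) t = subst (case_nat t \<sigma>) \<phi>"
proof -
  have "(\<lambda>i. subst_tm (case_nat t Var) (up \<sigma> i)) = case_nat t \<sigma>"
    by (rule ext) (simp add: up_def lift_tm_def subst_tm_subst_tm split: nat.split)
  then show ?thesis by (simp add: inst_def subst_subst)
qed

lemma wf_subst_tm: "wf_tm F t \<Longrightarrow> (\<And>i. wf_tm F (\<sigma> i)) \<Longrightarrow> wf_tm F (subst_tm \<sigma> t)"
  by (induction t) auto

lemma wf_lift_tm [simp]: "wf_tm F t \<Longrightarrow> wf_tm F (lift_tm t)"
  by (simp add: lift_tm_def wf_subst_tm)

lemma wf_lift_tmD: "wf_tm F (lift_tm t) \<Longrightarrow> wf_tm F t"
  by (induction t) (auto simp: lift_tm_def)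

lemma wf_up: "(\<And>i. wf_tm F (\<sigma> i)) \<Longrightarrow> wf_tm F (up \<sigma> i)"
  by (simp add: up_def split: nat.split)

lemma wf_subst: "wf_fm F \<phi> \<Longrightarrow> (\<And>i. wf_tm F (\<sigma> i)) \<Longrightarrow> wf_fm F (subst \<sigma> \<phi>)"
  by (induction \<phi> arbitrary: \<sigma>) (auto simp: wf_subst_tm wf_up)

lemma wf_lift [simp]: "wf_fm F \<phi> \<Longrightarrow> wf_fm F (lift \<phi>)"
  by (simp add: lift_def wf_subst)

lemma wf_inst [simp]: "wf_fm F \<phi> \<Longrightarrow> wf_tm F t \<Longrightarrow> wf_fm F (inst \<phi> t)"
  unfolding inst_def by (rule wf_subst) (auto split: nat.split)

lemma wf_numeral_tm [simp]: "wf_tm F (numeral_tm n)"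
  by (induction n) auto

lemma finite_fv_tm [simp]: "finite (fv_tm t)"
  by (induction t) auto

lemma finite_fv [simp]: "finite (fv \<phi>)"
proof (induction \<phi>)
  case (Forall \<phi>)
  then show ?case using finite_vimageI[of "fv \<phi>" Suc] by (simp add: vimage_def)
next
  case (Exists \<phi>)
  then show ?case using finite_vimageI[of "fv \<phi>" Suc] by (simp add: vimage_def)
qed auto

lemma deriv_wf: "deriv F \<Gamma> \<phi> \<Longrightarrow> wf_fm F \<phi>"
  by (induction rule: deriv.induct) auto

lemma deriv_weaken: "deriv F \<Gamma> \<phi> \<Longrightarrow> \<Gamma> \<subseteq> \<Delta> \<Longrightarrow> deriv F \<Delta> \<phi>"
proof (induction arbitrary: \<Delta> rule: deriv.induct)
  case (Assm \<phi> \<Gamma>)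
  then show ?case by (auto intro: deriv.Assm)
next
  case (Classical \<phi> \<Gamma>)
  then show ?case by (meson deriv.Classical insert_mono)
next
  case (DisjE \<Gamma> \<phi> \<psi> \<chi>)
  then show ?case by (meson deriv.DisjE insert_mono)
next
  case (ImplI \<phi> \<Gamma> \<psi>)
  then show ?case by (meson deriv.ImplI insert_mono)
next
  case (ForallI \<Gamma> \<phi>)
  then show ?case by (meson deriv.ForallI image_mono)
next
  case (ExistsE \<Gamma> \<phi> \<chi>)
  then show ?case by (meson deriv.ExistsE insert_mono image_mono)
qed (meson deriv.ConjI deriv.ConjE1 deriv.ConjE2 deriv.DisjI1 deriv.DisjI2 deriv.ImplE deriv.ForallE
    deriv.ExistsI deriv.EqualI deriv.EqualE)+

lemma consistent_subset: "consistent F \<Delta> \<Longrightarrow> \<Gamma> \<subseteq> \<Delta> \<Longrightarrow> consistent F \<Gamma>"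
  by (auto simp: consistent_def dest: deriv_weaken)

text \<open>Substitution crosses a binder as \<open>up \<sigma>\<close>, which commutes with
  \<open>lift\<close>; this keeps the eigenvariable conditions intact. Its purpose is to rename a
  fresh variable to index 0 in \<open>consistent_witness\<close>.\<close>

lemma deriv_subst:
  "deriv F \<Gamma> \<phi> \<Longrightarrow> (\<And>i. wf_tm F (\<sigma> i)) \<Longrightarrow> deriv F (subst \<sigma> ` \<Gamma>) (subst \<sigma> \<phi>)"
proof (induction arbitrary: \<sigma> rule: deriv.induct)
  case (Assm \<phi> \<Gamma>)
  then show ?case by (auto intro: deriv.Assm wf_subst)
next
  case (Classical \<phi> \<Gamma>)
  then show ?case by (simp add: deriv.Classical wf_subst)
next
  case (DisjI1 \<Gamma> \<phi> \<psi>)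
  then show ?case by (simp add: deriv.DisjI1 wf_subst)
next
  case (DisjI2 \<Gamma> \<psi> \<phi>)
  then show ?case by (simp add: deriv.DisjI2 wf_subst)
next
  case (DisjE \<Gamma> \<phi> \<psi> \<chi>)
  then have "deriv F (subst \<sigma> ` \<Gamma>) (Disj (subst \<sigma> \<phi>) (subst \<sigma> \<psi>))"
    and "deriv F (insert (subst \<sigma> \<phi>) (subst \<sigma> ` \<Gamma>)) (subst \<sigma> \<chi>)"
    and "deriv F (insert (subst \<sigma> \<psi>) (subst \<sigma> ` \<Gamma>)) (subst \<sigma> \<chi>)" by simp_all
  then show ?case by (rule deriv.DisjE)
next
  case (ImplI \<phi> \<Gamma> \<psi>)
  then show ?case by (simp add: deriv.ImplI wf_subst)
next
  case (ForallI \<Gamma> \<phi>)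
  have "deriv F (subst (up \<sigma>) ` lift ` \<Gamma>) (subst (up \<sigma>) \<phi>)"
    using ForallI wf_up by blast
  then show ?case by (auto intro: deriv.ForallI simp: image_image subst_lift)
next
  case (ForallE \<Gamma> \<phi> t)
  then show ?case by (auto simp: subst_inst intro!: deriv.ForallE wf_subst_tm)
next
  case (ExistsI \<Gamma> \<phi> t)
  then show ?case
    by (auto simp: subst_inst wf_subst_tm wf_subst wf_up
        intro!: deriv.ExistsI[of F _ _ "subst_tm \<sigma> t"])
next
  case (ExistsE \<Gamma> \<phi> \<chi>)
  have "deriv F (subst (up \<sigma>) ` insert \<phi> (lift ` \<Gamma>)) (subst (up \<sigma>) (lift \<chi>))"
    using ExistsE wf_up by blast
  then have "deriv F (insert (subst (up \<sigma>) \<phi>) (lift ` subst \<sigma> ` \<Gamma>)) (lift (subst \<sigma> \<chi>))"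
    by (simp add: image_image subst_lift)
  moreover have "deriv F (subst \<sigma> ` \<Gamma>) (Exists (subst (up \<sigma>) \<phi>))"
    using ExistsE by simp
  ultimately show ?case using ExistsE by (blast intro: deriv.ExistsE wf_subst)
next
  case (EqualI t \<Gamma>)
  then show ?case by (simp add: deriv.EqualI wf_subst_tm)
next
  case (EqualE \<Gamma> t u \<phi>)
  then have "deriv F (subst \<sigma> ` \<Gamma>) (Equal (subst_tm \<sigma> t) (subst_tm \<sigma> u))"
    and "deriv F (subst \<sigma> ` \<Gamma>) (inst (subst (up \<sigma>) \<phi>) (subst_tm \<sigma> t))"
    by (simp_all add: subst_inst[symmetric])
  then show ?case
    unfolding subst_inst by (rule deriv.EqualE) (simp add: EqualE wf_subst wf_up)
qed (auto intro: deriv.ConjI deriv.ConjE1 deriv.ConjE2 deriv.ImplE)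

text \<open>Compactness: an inconsistency in a union of an increasing chain already occurs at one
  stage. In the quantifier rules, a finite set of lifted assumptions is the lift of a finite
  set.\<close>

lemma deriv_finite: "deriv F \<Gamma> \<phi> \<Longrightarrow> \<exists>\<Delta>\<subseteq>\<Gamma>. finite \<Delta> \<and> deriv F \<Delta> \<phi>"
proof (induction rule: deriv.induct)
  case (Assm \<phi> \<Gamma>)
  then show ?case by (intro exI[of _ "{\<phi>}"]) (auto intro: deriv.Assm)
next
  case (Classical \<phi> \<Gamma>)
  then obtain \<Delta> where \<Delta>: "\<Delta> \<subseteq> insert (Neg \<phi>) \<Gamma>" "finite \<Delta>" and d: "deriv F \<Delta> Falsum" by blast
  show ?case using \<Delta> Classical.hyps
    by (intro exI[of _ "\<Delta> - {Neg \<phi>}"] conjI deriv.Classical[OF deriv_weaken[OF d]]) auto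
next
  case (ConjI \<Gamma> \<phi> \<psi>)
  then obtain \<Delta> \<Delta>' where \<Delta>: "\<Delta> \<subseteq> \<Gamma>" "finite \<Delta>" "\<Delta>' \<subseteq> \<Gamma>" "finite \<Delta>'"
    and d: "deriv F \<Delta> \<phi>" "deriv F \<Delta>' \<psi>" by blast
  show ?case using \<Delta>
    by (intro exI[of _ "\<Delta> \<union> \<Delta>'"] conjI deriv.ConjI[OF deriv_weaken[OF d(1)] deriv_weaken[OF d(2)]])
      auto
next
  case (DisjE \<Gamma> \<phi> \<psi> \<chi>)
  from DisjE.IH(1) obtain \<Delta>1 where 1: "\<Delta>1 \<subseteq> \<Gamma>" "finite \<Delta>1" "deriv F \<Delta>1 (Disj \<phi> \<psi>)" by blast
  from DisjE.IH(2) obtain \<Delta>2 where 2: "\<Delta>2 \<subseteq> insert \<phi> \<Gamma>" "finite \<Delta>2" "deriv F \<Delta>2 \<chi>" by blast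
  from DisjE.IH(3) obtain \<Delta>3 where 3: "\<Delta>3 \<subseteq> insert \<psi> \<Gamma>" "finite \<Delta>3" "deriv F \<Delta>3 \<chi>" by blast
  show ?case using 1(1,2) 2(1,2) 3(1,2)
    by (intro exI[of _ "\<Delta>1 \<union> (\<Delta>2 - {\<phi>}) \<union> (\<Delta>3 - {\<psi>})"] conjI
        deriv.DisjE[OF deriv_weaken[OF 1(3)] deriv_weaken[OF 2(3)] deriv_weaken[OF 3(3)]]) auto
next
  case (ImplI \<phi> \<Gamma> \<psi>)
  then obtain \<Delta> where \<Delta>: "\<Delta> \<subseteq> insert \<phi> \<Gamma>" "finite \<Delta>" and d: "deriv F \<Delta> \<psi>" by blast
  show ?case using \<Delta> ImplI.hyps
    by (intro exI[of _ "\<Delta> - {\<phi>}"] conjI deriv.ImplI[OF deriv_weaken[OF d]]) auto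
next
  case (ImplE \<Gamma> \<phi> \<psi>)
  then obtain \<Delta> \<Delta>' where \<Delta>: "\<Delta> \<subseteq> \<Gamma>" "finite \<Delta>" "\<Delta>' \<subseteq> \<Gamma>" "finite \<Delta>'"
    and d: "deriv F \<Delta> (Impl \<phi> \<psi>)" "deriv F \<Delta>' \<phi>" by blast
  show ?case using \<Delta>
    by (intro exI[of _ "\<Delta> \<union> \<Delta>'"] conjI deriv.ImplE[OF deriv_weaken[OF d(1)] deriv_weaken[OF d(2)]])
      auto
next
  case (ForallI \<Gamma> \<phi>)
  then obtain \<Delta> where "\<Delta> \<subseteq> \<Gamma>" "finite \<Delta>" "deriv F (lift ` \<Delta>) \<phi>"
    by (metis finite_subset_image)
  then show ?case by (blast intro: deriv.ForallI)
next
  case (ExistsE \<Gamma> \<phi> \<chi>)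
  from ExistsE.IH(1) obtain \<Delta> where \<Delta>: "\<Delta> \<subseteq> \<Gamma>" "finite \<Delta>" "deriv F \<Delta> (Exists \<phi>)" by blast
  from ExistsE.IH(2) obtain \<Delta>' where
    \<Delta>': "\<Delta>' \<subseteq> insert \<phi> (lift ` \<Gamma>)" "finite \<Delta>'" "deriv F \<Delta>' (lift \<chi>)" by blast
  have "finite (\<Delta>' - {\<phi>})" "\<Delta>' - {\<phi>} \<subseteq> lift ` \<Gamma>" using \<Delta>' by auto
  then obtain \<Theta> where \<Theta>: "\<Theta> \<subseteq> \<Gamma>" "finite \<Theta>" "\<Delta>' - {\<phi>} = lift ` \<Theta>"
    by (metis finite_subset_image)
  then have "\<Delta>' \<subseteq> insert \<phi> (lift ` (\<Delta> \<union> \<Theta>))" by blast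
  with \<Delta>(1,2) \<Theta>(1,2) ExistsE.hyps show ?case
    by (intro exI[of _ "\<Delta> \<union> \<Theta>"] conjI
        deriv.ExistsE[OF deriv_weaken[OF \<Delta>(3)] deriv_weaken[OF \<Delta>'(3)]]) auto
next
  case (EqualE \<Gamma> t u \<phi>)
  then obtain \<Delta> \<Delta>' where \<Delta>: "\<Delta> \<subseteq> \<Gamma>" "finite \<Delta>" "\<Delta>' \<subseteq> \<Gamma>" "finite \<Delta>'"
    and d: "deriv F \<Delta> (Equal t u)" "deriv F \<Delta>' (inst \<phi> t)" by blast
  show ?case using \<Delta> EqualE.hyps
    by (intro exI[of _ "\<Delta> \<union> \<Delta>'"] conjI deriv.EqualE[OF deriv_weaken[OF d(1)] deriv_weaken[OF d(2)]])
      auto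
qed (meson deriv.ConjE1 deriv.ConjE2 deriv.DisjI1 deriv.DisjI2 deriv.ForallE deriv.ExistsI
    deriv.EqualI finite.emptyI empty_subsetI)+


section \<open>Structures and soundness\<close>

text \<open>
  Only structures with carrier \<^typ>\<open>nat\<close> are considered; they suffice because every model of PA is
  infinite and the language is countable.
\<close>

record struct =
  zr :: nat
  sc :: "nat \<Rightarrow> nat"
  ad :: "nat \<Rightarrow> nat \<Rightarrow> nat"
  ml :: "nat \<Rightarrow> nat \<Rightarrow> nat"
  fn :: "pfun \<Rightarrow> nat list \<Rightarrow> nat"

fun val :: "struct \<Rightarrow> (nat \<Rightarrow> nat) \<Rightarrow> tm \<Rightarrow> nat" where
  "val M e (Var i) = e i"
| "val M e Zero = zr M"
| "val M e (Succ t) = sc M (val M e t)"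
| "val M e (Add t u) = ad M (val M e t) (val M e u)"
| "val M e (Mul t u) = ml M (val M e t) (val M e u)"
| "val M e (Fn f ts) = fn M f (map (val M e) ts)"

fun sat :: "struct \<Rightarrow> (nat \<Rightarrow> nat) \<Rightarrow> fm \<Rightarrow> bool" where
  "sat M e (Equal t u) \<longleftrightarrow> val M e t = val M e u"
| "sat M e Falsum \<longleftrightarrow> False"
| "sat M e (Conj \<phi> \<psi>) \<longleftrightarrow> sat M e \<phi> \<and> sat M e \<psi>"
| "sat M e (Disj \<phi> \<psi>) \<longleftrightarrow> sat M e \<phi> \<or> sat M e \<psi>"
| "sat M e (Impl \<phi> \<psi>) \<longleftrightarrow> (sat M e \<phi> \<longrightarrow> sat M e \<psi>)"
| "sat M e (Forall \<phi>) \<longleftrightarrow> (\<forall>a. sat M (case_nat a e) \<phi>)"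
| "sat M e (Exists \<phi>) \<longleftrightarrow> (\<exists>a. sat M (case_nat a e) \<phi>)"

definition models :: "struct \<Rightarrow> fm set \<Rightarrow> bool" where
  "models M \<Gamma> \<longleftrightarrow> (\<forall>\<phi>\<in>\<Gamma>. \<forall>e. sat M e \<phi>)"

lemma val_cong: "(\<And>i. i \<in> fv_tm t \<Longrightarrow> e i = e' i) \<Longrightarrow> val M e t = val M e' t"
proof (induction t)
  case (Fn f ts)
  have "map (val M e) ts = map (val M e') ts"
    by (rule map_cong[OF refl]) (auto intro!: Fn.IH Fn.prems)
  then show ?case by (metis val.simps(6))
qed auto

lemma sat_cong: "(\<And>i. i \<in> fv \<phi> \<Longrightarrow> e i = e' i) \<Longrightarrow> sat M e \<phi> = sat M e' \<phi>"
proof (induction \<phi> arbitrary: e e')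
  case (Equal t u)
  then show ?case using val_cong[of t e e'] val_cong[of u e e'] by auto
next
  case (Forall \<phi>)
  have "sat M (case_nat a e) \<phi> = sat M (case_nat a e') \<phi>" for a
    by (rule Forall.IH) (auto simp: Forall.prems split: nat.split)
  then show ?case by simp
next
  case (Exists \<phi>)
  have "sat M (case_nat a e) \<phi> = sat M (case_nat a e') \<phi>" for a
    by (rule Exists.IH) (auto simp: Exists.prems split: nat.split)
  then show ?case by simp
next
  case (Conj \<phi> \<psi>)
  have "sat M e \<phi> = sat M e' \<phi>" "sat M e \<psi> = sat M e' \<psi>"
    using Conj.prems by (auto intro!: Conj.IH)
  then show ?case by simp
next
  case (Disj \<phi> \<psi>)
  have "sat M e \<phi> = sat M e' \<phi>" "sat M e \<psi> = sat M e' \<psi>"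
    using Disj.prems by (auto intro!: Disj.IH)
  then show ?case by simp
next
  case (Impl \<phi> \<psi>)
  have "sat M e \<phi> = sat M e' \<phi>" "sat M e \<psi> = sat M e' \<psi>"
    using Impl.prems by (auto intro!: Impl.IH)
  then show ?case by simp
qed simp

lemma val_subst: "val M e (subst_tm \<sigma> t) = val M (\<lambda>i. val M e (\<sigma> i)) t"
  by (induction t) (auto intro!: arg_cong[where f = "fn M _"])

lemma val_lift [simp]: "val M (case_nat a e) (lift_tm t) = val M e t"
  by (simp add: lift_tm_def val_subst)

lemma val_up: "(\<lambda>i. val M (case_nat a e) (up \<sigma> i)) = case_nat a (\<lambda>i. val M e (\<sigma> i))"
  by (rule ext) (simp add: up_def split: nat.split)

lemma sat_subst: "sat M e (subst \<sigma> \<phi>) = sat M (\<lambda>i. val M e (\<sigma> i)) \<phi>"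
  by (induction \<phi> arbitrary: e \<sigma>) (simp_all add: val_subst val_up)

lemma sat_lift [simp]: "sat M (case_nat a e) (lift \<phi>) = sat M e \<phi>"
  by (simp add: lift_def sat_subst)

lemma sat_inst: "sat M e (inst \<phi> t) = sat M (case_nat (val M e t) e) \<phi>"
proof -
  have "(\<lambda>i. val M e (case_nat t Var i)) = case_nat (val M e t) e"
    by (rule ext) (simp split: nat.split)
  then show ?thesis by (simp add: inst_def sat_subst)
qed

lemma soundness: "deriv F \<Gamma> \<phi> \<Longrightarrow> (\<And>\<gamma>. \<gamma> \<in> \<Gamma> \<Longrightarrow> sat M e \<gamma>) \<Longrightarrow> sat M e \<phi>"
proof (induction arbitrary: e rule: deriv.induct)
  case (Classical \<phi> \<Gamma>)
  then show ?case by fastforce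
next
  case (DisjE \<Gamma> \<phi> \<psi> \<chi>)
  then have "sat M e (Disj \<phi> \<psi>)" by blast
  then show ?case using DisjE by auto
next
  case (ForallI \<Gamma> \<phi>)
  have "sat M (case_nat a e) \<phi>" for a using ForallI.prems by (intro ForallI.IH) auto
  then show ?case by simp
next
  case (ExistsE \<Gamma> \<phi> \<chi>)
  have "sat M e (Exists \<phi>)" using ExistsE.IH(1) ExistsE.prems by blast
  then obtain a where "sat M (case_nat a e) \<phi>" by auto
  then have "sat M (case_nat a e) (lift \<chi>)" using ExistsE.prems by (intro ExistsE.IH(2)) auto
  then show ?case by simp
next
  case (EqualE \<Gamma> t u \<phi>)
  then show ?case by (simp add: sat_inst)
qed (auto simp: sat_inst)

lemma models_deriv: "models M \<Gamma> \<Longrightarrow> deriv F \<Gamma> \<phi> \<Longrightarrow> sat M e \<phi>"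
  by (auto simp: models_def intro: soundness)

lemma all_sat_Forall: "(\<forall>e. sat M e (Forall \<phi>)) \<longleftrightarrow> (\<forall>e. sat M e \<phi>)"
proof -
  have "case_nat (e 0) (\<lambda>i. e (Suc i)) = e" for e :: "nat \<Rightarrow> nat"
    by (rule ext) (simp split: nat.split)
  then show ?thesis by (metis sat.simps(6))
qed

text \<open>Allows a closed axiom to be used through its matrix, at whatever environment is
  convenient.\<close>

lemma all_sat_alls: "(\<forall>e. sat M e (alls n \<phi>)) \<longleftrightarrow> (\<forall>e. sat M e \<phi>)"
  unfolding alls_def
proof (induction n)
  case (Suc n)
  then show ?case using all_sat_Forall by simp
qed simp


section \<open>Completeness\<close>

instance pfun :: countable by countable_datatype
instance tm :: countable by countable_datatype
instance fm :: countable by countable_datatype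

text \<open>The renaming that sends \<open>m\<close> to index 0 and shifts all other variables acts
  as \<open>lift\<close> on \<open>\<Gamma>\<close>, since \<open>m\<close> is fresh, and turns the
  instance back into \<open>\<chi>\<close>. A refutation thus becomes the minor premise of
  \<open>ExistsE\<close>.\<close>

lemma consistent_witness:
  assumes "consistent F \<Gamma>" and ex: "Exists \<chi> \<in> \<Gamma>" and wf: "\<And>\<gamma>. \<gamma> \<in> \<Gamma> \<Longrightarrow> wf_fm F \<gamma>"
    and fresh: "\<And>\<gamma>. \<gamma> \<in> \<Gamma> \<Longrightarrow> m \<notin> fv \<gamma>"
  shows "consistent F (insert (inst \<chi> (Var m)) \<Gamma>)"
  unfolding consistent_def
proof
  assume *: "deriv F (insert (inst \<chi> (Var m)) \<Gamma>) Falsum"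
  define \<sigma> where "\<sigma> = (\<lambda>i. if i = m then Var 0 else Var (Suc i))"
  have "subst \<sigma> (inst \<chi> (Var m)) = subst (\<lambda>i. subst_tm \<sigma> (case_nat (Var m) Var i)) \<chi>"
    by (simp add: inst_def subst_subst)
  also have "\<dots> = subst Var \<chi>"
    using fresh[OF ex] by (intro subst_cong) (auto simp: \<sigma>_def split: nat.split)
  finally have "subst \<sigma> (inst \<chi> (Var m)) = \<chi>" by simp
  moreover have "subst \<sigma> \<gamma> = lift \<gamma>" if "\<gamma> \<in> \<Gamma>" for \<gamma>
    unfolding lift_def using fresh[OF that] by (intro subst_cong) (auto simp: \<sigma>_def)
  then have "subst \<sigma> ` \<Gamma> = lift ` \<Gamma>" by (rule image_cong[OF refl])
  moreover have "deriv F (subst \<sigma> ` insert (inst \<chi> (Var m)) \<Gamma>) (subst \<sigma> Falsum)"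
    by (rule deriv_subst[OF *]) (simp add: \<sigma>_def)
  ultimately have "deriv F (insert \<chi> (lift ` \<Gamma>)) (lift Falsum)" by (simp add: lift_def)
  then have "deriv F \<Gamma> Falsum"
    using ex wf deriv.Assm deriv.ExistsE by (metis wf_fm.simps(2))
  with assms(1) show False by (simp add: consistent_def)
qed

definition fresh_var :: "fm set \<Rightarrow> nat" where
  "fresh_var \<Gamma> = (SOME m. m \<notin> (\<Union>\<gamma>\<in>\<Gamma>. fv \<gamma>))"

text \<open>Variables serve as Henkin constants, so the language stays the same. The price is the
  invariant that only finitely many variables occur free at each stage, so that a fresh one can
  always be chosen.\<close>

definition add_fm :: "pfun set \<Rightarrow> fm \<Rightarrow> fm set \<Rightarrow> fm set" where
  "add_fm F \<phi> \<Gamma> =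
     (if wf_fm F \<phi> \<and> consistent F (insert \<phi> \<Gamma>)
      then insert \<phi> \<Gamma> \<union> {inst \<chi> (Var (fresh_var (insert \<phi> \<Gamma>))) | \<chi>. \<phi> = Exists \<chi>}
      else \<Gamma>)"

primrec henkin :: "pfun set \<Rightarrow> fm set \<Rightarrow> nat \<Rightarrow> fm set" where
  "henkin F \<Gamma> 0 = \<Gamma>"
| "henkin F \<Gamma> (Suc n) = add_fm F (from_nat n) (henkin F \<Gamma> n)"

lemma add_fm_invariant:
  assumes "consistent F \<Gamma>" "\<forall>\<gamma>\<in>\<Gamma>. wf_fm F \<gamma>" "finite (\<Union>\<gamma>\<in>\<Gamma>. fv \<gamma>)"
  shows "consistent F (add_fm F \<phi> \<Gamma>) \<and> (\<forall>\<gamma>\<in>add_fm F \<phi> \<Gamma>. wf_fm F \<gamma>) \<and>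
    finite (\<Union>\<gamma>\<in>add_fm F \<phi> \<Gamma>. fv \<gamma>)"
proof (cases "wf_fm F \<phi> \<and> consistent F (insert \<phi> \<Gamma>)")
  case True
  let ?\<Delta> = "insert \<phi> \<Gamma>"
  have "finite (\<Union>\<gamma>\<in>?\<Delta>. fv \<gamma>)" using assms by simp
  then have "\<exists>m. m \<notin> (\<Union>\<gamma>\<in>?\<Delta>. fv \<gamma>)" using ex_new_if_finite infinite_UNIV_nat by blast
  then have "fresh_var ?\<Delta> \<notin> (\<Union>\<gamma>\<in>?\<Delta>. fv \<gamma>)" unfolding fresh_var_def by (rule someI_ex)
  then have fresh: "fresh_var ?\<Delta> \<notin> fv \<gamma>" if "\<gamma> \<in> ?\<Delta>" for \<gamma> using that by blast
  show ?thesis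
  proof (cases "\<exists>\<chi>. \<phi> = Exists \<chi>")
    case ex: True
    then obtain \<chi> where \<chi>: "\<phi> = Exists \<chi>" by blast
    have eq: "add_fm F \<phi> \<Gamma> = insert (inst \<chi> (Var (fresh_var ?\<Delta>))) ?\<Delta>"
      using True \<chi> by (auto simp: add_fm_def)
    have "consistent F (insert (inst \<chi> (Var (fresh_var ?\<Delta>))) ?\<Delta>)"
      using True assms \<chi> fresh by (intro consistent_witness) auto
    then show ?thesis using eq True assms \<chi> finite_fv[of "Exists \<chi>"] by auto
  next
    case False
    then show ?thesis using True assms by (auto simp: add_fm_def)
  qed
next
  case False
  then have "add_fm F \<phi> \<Gamma> = \<Gamma>" unfolding add_fm_def by (rule if_not_P)
  then show ?thesis using assms by simp
qed

definition complete_henkin :: "pfun set \<Rightarrow> fm set \<Rightarrow> bool" where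
  "complete_henkin F \<Gamma> \<longleftrightarrow> consistent F \<Gamma> \<and> (\<forall>\<gamma>\<in>\<Gamma>. wf_fm F \<gamma>) \<and>
     (\<forall>\<phi>. wf_fm F \<phi> \<longrightarrow> consistent F (insert \<phi> \<Gamma>) \<longrightarrow> \<phi> \<in> \<Gamma>) \<and>
     (\<forall>\<chi>. Exists \<chi> \<in> \<Gamma> \<longrightarrow> (\<exists>m. inst \<chi> (Var m) \<in> \<Gamma>))"

lemma henkin_extension:
  assumes "consistent F \<Gamma>" "\<forall>\<gamma>\<in>\<Gamma>. wf_fm F \<gamma>" "finite (\<Union>\<gamma>\<in>\<Gamma>. fv \<gamma>)"
  shows "\<exists>\<Delta>. \<Gamma> \<subseteq> \<Delta> \<and> complete_henkin F \<Delta>"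
proof -
  let ?H = "henkin F \<Gamma>"
  have inv: "consistent F (?H n) \<and> (\<forall>\<gamma>\<in>?H n. wf_fm F \<gamma>) \<and> finite (\<Union>\<gamma>\<in>?H n. fv \<gamma>)" for n
  proof (induction n)
    case (Suc n)
    then show ?case using add_fm_invariant[of F "?H n"] by simp
  qed (use assms in simp)
  have mono: "?H m \<subseteq> ?H n" if "m \<le> n" for m n
    by (rule lift_Suc_mono_le[OF _ that]) (auto simp: add_fm_def)
  define \<Delta> where "\<Delta> = (\<Union>n. ?H n)"
  have sub: "\<exists>n. \<Theta> \<subseteq> ?H n" if "finite \<Theta>" "\<Theta> \<subseteq> \<Delta>" for \<Theta>
    using that
  proof (induction \<Theta>)
    case (insert \<phi> \<Theta>)
    then obtain m n where "\<Theta> \<subseteq> ?H m" "\<phi> \<in> ?H n" by (auto simp: \<Delta>_def)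
    then have "insert \<phi> \<Theta> \<subseteq> ?H (max m n)"
      using mono[of m "max m n"] mono[of n "max m n"] by auto
    then show ?case by blast
  qed simp
  have "consistent F \<Delta>"
    unfolding consistent_def
  proof
    assume "deriv F \<Delta> Falsum"
    from deriv_finite[OF this] obtain \<Theta> where \<Theta>: "\<Theta> \<subseteq> \<Delta>" "finite \<Theta>" "deriv F \<Theta> Falsum"
      by blast
    obtain n where "\<Theta> \<subseteq> ?H n" using sub[OF \<Theta>(2,1)] by blast
    then have "deriv F (?H n) Falsum" by (rule deriv_weaken[OF \<Theta>(3)])
    then show False using inv[of n] by (simp add: consistent_def)
  qed
  \<comment> \<open>A formula consistent with the union is consistent with the stage at which its
    turn comes, and was added there.\<close>
  moreover have "\<phi> \<in> \<Delta>" if "wf_fm F \<phi>" "consistent F (insert \<phi> \<Delta>)" for \<phi>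
  proof -
    have "insert \<phi> (?H (to_nat \<phi>)) \<subseteq> insert \<phi> \<Delta>" by (auto simp: \<Delta>_def)
    then have "consistent F (insert \<phi> (?H (to_nat \<phi>)))"
      using that(2) consistent_subset by blast
    then have "\<phi> \<in> ?H (Suc (to_nat \<phi>))" using that(1) by (simp add: add_fm_def)
    then show ?thesis unfolding \<Delta>_def by blast
  qed
  \<comment> \<open>An existential formula may be present before its turn; when its turn comes it is
    added again and receives its witness.\<close>
  moreover have "\<exists>m. inst \<chi> (Var m) \<in> \<Delta>" if "Exists \<chi> \<in> \<Delta>" for \<chi>
  proof -
    let ?n = "to_nat (Exists \<chi>)"
    have "insert (Exists \<chi>) (?H ?n) \<subseteq> \<Delta>" using that by (auto simp: \<Delta>_def)
    then have "consistent F (insert (Exists \<chi>) (?H ?n))"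
      using \<open>consistent F \<Delta>\<close> consistent_subset by blast
    moreover have "wf_fm F (Exists \<chi>)" using that inv unfolding \<Delta>_def by blast
    ultimately have "\<exists>m. inst \<chi> (Var m) \<in> ?H (Suc ?n)" by (auto simp: add_fm_def)
    then show ?thesis unfolding \<Delta>_def by blast
  qed
  moreover have "\<forall>\<gamma>\<in>\<Delta>. wf_fm F \<gamma>" using inv by (auto simp: \<Delta>_def)
  moreover have "\<Gamma> \<subseteq> \<Delta>" unfolding \<Delta>_def using henkin.simps(1) by blast
  ultimately show ?thesis unfolding complete_henkin_def by blast
qed

section \<open>Truth conditions of a complete Henkin set and its term model\<close>

lemma subst_case_nat_lift_tm [simp]: "subst_tm (case_nat t Var) (lift_tm u) = u"
  by (simp add: lift_tm_def subst_tm_subst_tm)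

lemma inst_simps [simp]:
  "inst (Equal t u) v = Equal (subst_tm (case_nat v Var) t) (subst_tm (case_nat v Var) u)"
  "inst Falsum v = Falsum"
  "inst (Impl \<phi> \<psi>) v = Impl (inst \<phi> v) (inst \<psi> v)"
  by (simp_all add: inst_def)

context
  fixes F \<Gamma>
  assumes complete_henkin: "complete_henkin F \<Gamma>"
begin

lemma henkin_wf: "\<phi> \<in> \<Gamma> \<Longrightarrow> wf_fm F \<phi>"
  using complete_henkin by (auto simp: complete_henkin_def)

lemma henkin_closed: "deriv F \<Gamma> \<phi> \<Longrightarrow> \<phi> \<in> \<Gamma>"
proof (rule ccontr)
  assume d: "deriv F \<Gamma> \<phi>" and "\<phi> \<notin> \<Gamma>"
  then have "deriv F (insert \<phi> \<Gamma>) Falsum"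
    using complete_henkin deriv_wf[OF d] by (auto simp: complete_henkin_def consistent_def)
  then have "deriv F \<Gamma> Falsum" using d deriv_wf[OF d] deriv.ImplI deriv.ImplE by blast
  then show False using complete_henkin by (simp add: complete_henkin_def consistent_def)
qed

lemma henkin_deriv: "\<phi> \<in> \<Gamma> \<Longrightarrow> deriv F \<Gamma> \<phi>"
  by (simp add: deriv.Assm henkin_wf)

lemma henkin_Falsum: "Falsum \<notin> \<Gamma>"
  using complete_henkin henkin_deriv by (auto simp: complete_henkin_def consistent_def)

lemma henkin_Neg: "wf_fm F \<phi> \<Longrightarrow> Neg \<phi> \<in> \<Gamma> \<longleftrightarrow> \<phi> \<notin> \<Gamma>"
proof
  assume "Neg \<phi> \<in> \<Gamma>"
  then show "\<phi> \<notin> \<Gamma>" using henkin_Falsum henkin_closed henkin_deriv deriv.ImplE by metis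
next
  assume wf: "wf_fm F \<phi>" and "\<phi> \<notin> \<Gamma>"
  then have "deriv F (insert \<phi> \<Gamma>) Falsum"
    using complete_henkin by (auto simp: complete_henkin_def consistent_def)
  then show "Neg \<phi> \<in> \<Gamma>" using wf deriv.ImplI henkin_closed by blast
qed

lemma henkin_Conj: "Conj \<phi> \<psi> \<in> \<Gamma> \<longleftrightarrow> \<phi> \<in> \<Gamma> \<and> \<psi> \<in> \<Gamma>"
  using henkin_closed henkin_deriv deriv.ConjI deriv.ConjE1 deriv.ConjE2 by metis

lemma henkin_Impl:
  assumes "wf_fm F \<phi>" "wf_fm F \<psi>"
  shows "Impl \<phi> \<psi> \<in> \<Gamma> \<longleftrightarrow> (\<phi> \<in> \<Gamma> \<longrightarrow> \<psi> \<in> \<Gamma>)"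
proof
  assume "Impl \<phi> \<psi> \<in> \<Gamma>"
  then show "\<phi> \<in> \<Gamma> \<longrightarrow> \<psi> \<in> \<Gamma>" using henkin_closed henkin_deriv deriv.ImplE by metis
next
  assume "\<phi> \<in> \<Gamma> \<longrightarrow> \<psi> \<in> \<Gamma>"
  then consider "Neg \<phi> \<in> \<Gamma>" | "\<psi> \<in> \<Gamma>" using henkin_Neg assms by blast
  then have "deriv F (insert \<phi> \<Gamma>) \<psi>"
  proof cases
    case 1
    have "deriv F (insert \<phi> \<Gamma>) Falsum"
      using deriv.ImplE[of F "insert \<phi> \<Gamma>" \<phi> Falsum] deriv.Assm 1 assms henkin_wf by blast
    then have "deriv F (insert (Neg \<psi>) (insert \<phi> \<Gamma>)) Falsum" by (rule deriv_weaken) blast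
    from deriv.Classical[OF this assms(2)] show ?thesis .
  next
    case 2
    then show ?thesis using assms by (intro deriv.Assm) auto
  qed
  then show "Impl \<phi> \<psi> \<in> \<Gamma>" using assms by (intro henkin_closed deriv.ImplI)
qed

lemma henkin_Disj:
  assumes "wf_fm F \<phi>" "wf_fm F \<psi>"
  shows "Disj \<phi> \<psi> \<in> \<Gamma> \<longleftrightarrow> \<phi> \<in> \<Gamma> \<or> \<psi> \<in> \<Gamma>"
proof
  assume *: "Disj \<phi> \<psi> \<in> \<Gamma>"
  show "\<phi> \<in> \<Gamma> \<or> \<psi> \<in> \<Gamma>"
  proof (rule ccontr)
    assume "\<not> (\<phi> \<in> \<Gamma> \<or> \<psi> \<in> \<Gamma>)"
    then have "deriv F (insert \<phi> \<Gamma>) Falsum" "deriv F (insert \<psi> \<Gamma>) Falsum"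
      using complete_henkin assms by (auto simp: complete_henkin_def consistent_def)
    with henkin_deriv[OF *] have "deriv F \<Gamma> Falsum" by (rule deriv.DisjE)
    then show False using henkin_closed henkin_Falsum by blast
  qed
next
  assume "\<phi> \<in> \<Gamma> \<or> \<psi> \<in> \<Gamma>"
  then show "Disj \<phi> \<psi> \<in> \<Gamma>"
    using assms henkin_closed henkin_deriv deriv.DisjI1 deriv.DisjI2 by metis
qed

lemma henkin_Exists:
  assumes "wf_fm F \<chi>"
  shows "Exists \<chi> \<in> \<Gamma> \<longleftrightarrow> (\<exists>t. wf_tm F t \<and> inst \<chi> t \<in> \<Gamma>)"
proof
  assume "Exists \<chi> \<in> \<Gamma>"
  then obtain m where "inst \<chi> (Var m) \<in> \<Gamma>" using complete_henkin by (auto simp: complete_henkin_def)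
  then show "\<exists>t. wf_tm F t \<and> inst \<chi> t \<in> \<Gamma>" by (intro exI[of _ "Var m"]) simp
next
  assume "\<exists>t. wf_tm F t \<and> inst \<chi> t \<in> \<Gamma>"
  then obtain t where t: "wf_tm F t" "inst \<chi> t \<in> \<Gamma>" by blast
  from henkin_closed[OF deriv.ExistsI[OF henkin_deriv[OF t(2)] t(1) assms]]
  show "Exists \<chi> \<in> \<Gamma>" .
qed

text \<open>The construction supplies witnesses for existential formulas only. The universal case
  goes through \<open>Exists (Neg \<chi>)\<close>: if it is absent, its negation refutes
  \<open>Neg \<chi>\<close> for a new variable.\<close>

lemma henkin_Forall:
  assumes "wf_fm F \<chi>"
  shows "Forall \<chi> \<in> \<Gamma> \<longleftrightarrow> (\<forall>t. wf_tm F t \<longrightarrow> inst \<chi> t \<in> \<Gamma>)"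
proof
  assume "Forall \<chi> \<in> \<Gamma>"
  from deriv.ForallE[OF henkin_deriv[OF this]]
  show "\<forall>t. wf_tm F t \<longrightarrow> inst \<chi> t \<in> \<Gamma>" by (simp add: henkin_closed)
next
  assume *: "\<forall>t. wf_tm F t \<longrightarrow> inst \<chi> t \<in> \<Gamma>"
  let ?\<nu> = "Exists (Neg \<chi>)" and ?\<rho> = "\<lambda>i. Var (Suc i)"
  have "?\<nu> \<notin> \<Gamma>"
    using henkin_Exists[of "Neg \<chi>"] * assms henkin_Neg[of "inst \<chi> _"] by auto
  then have "Neg ?\<nu> \<in> \<Gamma>" using assms henkin_Neg by simp
  let ?\<Delta> = "insert (Neg \<chi>) (lift ` \<Gamma>)"
  \<comment> \<open>Under the lifted assumptions index 0 is the eigenvariable, and it is itself the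
    witness for \<open>lift ?\<nu>\<close>.\<close>
  have "case_nat (Var 0) ?\<rho> = Var" by (rule ext) (simp split: nat.split)
  then have "inst (Neg (subst (up ?\<rho>) \<chi>)) (Var 0) = Neg \<chi>" by (simp add: inst_subst_up)
  moreover have "deriv F ?\<Delta> (Neg \<chi>)" using assms by (intro deriv.Assm) auto
  ultimately have "deriv F ?\<Delta> (inst (Neg (subst (up ?\<rho>) \<chi>)) (Var 0))" by (rule ssubst)
  then have "deriv F ?\<Delta> (Exists (Neg (subst (up ?\<rho>) \<chi>)))"
    by (rule deriv.ExistsI) (use assms in \<open>auto intro!: wf_subst wf_up\<close>)
  then have 1: "deriv F ?\<Delta> (lift ?\<nu>)" by (simp add: lift_def)
  have "lift (Neg ?\<nu>) = Neg (lift ?\<nu>)" by (simp add: lift_def)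
  then have "Neg (lift ?\<nu>) \<in> ?\<Delta>" using \<open>Neg ?\<nu> \<in> \<Gamma>\<close> by (metis imageI insertCI)
  then have "deriv F ?\<Delta> (Neg (lift ?\<nu>))" using assms by (intro deriv.Assm) auto
  from this 1 have "deriv F ?\<Delta> Falsum" by (rule deriv.ImplE)
  then have "deriv F (lift ` \<Gamma>) \<chi>" by (rule deriv.Classical[OF _ assms])
  then show "Forall \<chi> \<in> \<Gamma>" by (intro henkin_closed deriv.ForallI)
qed

lemma henkin_Leibniz:
  "Equal t u \<in> \<Gamma> \<Longrightarrow> inst \<phi> t \<in> \<Gamma> \<Longrightarrow> wf_fm F \<phi> \<Longrightarrow> inst \<phi> u \<in> \<Gamma>"
  by (rule henkin_closed, rule deriv.EqualE[OF henkin_deriv henkin_deriv])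

lemma henkin_refl: "wf_tm F t \<Longrightarrow> Equal t t \<in> \<Gamma>"
  by (intro henkin_closed deriv.EqualI)

lemma henkin_sym: "Equal t u \<in> \<Gamma> \<Longrightarrow> Equal u t \<in> \<Gamma>"
  using henkin_Leibniz[of t u "Equal (Var 0) (lift_tm t)"] henkin_refl[of t] henkin_wf[of "Equal t u"]
  by simp

lemma henkin_trans: "Equal t u \<in> \<Gamma> \<Longrightarrow> Equal u v \<in> \<Gamma> \<Longrightarrow> Equal t v \<in> \<Gamma>"
  using henkin_Leibniz[of u v "Equal (lift_tm t) (Var 0)"] henkin_wf[of "Equal t u"] by simp

text \<open>A context is given as a term whose variable 0 marks the hole.\<close>

lemma henkin_context:
  assumes "Equal t u \<in> \<Gamma>" "wf_tm F c"
  shows "Equal (subst_tm (case_nat t Var) c) (subst_tm (case_nat u Var) c) \<in> \<Gamma>"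
proof -
  let ?c = "subst_tm (case_nat t Var) c"
  have "wf_tm F t" using henkin_wf[OF assms(1)] by simp
  then have "wf_tm F ?c" using assms(2) by (auto intro!: wf_subst_tm split: nat.split)
  then show ?thesis
    using henkin_Leibniz[OF assms(1), of "Equal (lift_tm ?c) c"] henkin_refl[of ?c] assms(2) by simp
qed

text \<open>The arguments are exchanged one at a time from the left; \<open>as\<close> holds those
  already exchanged, so each exchange is a context with a single hole.\<close>

lemma henkin_Fn:
  assumes "list_all2 (\<lambda>t u. Equal t u \<in> \<Gamma>) ts us" "f \<in> F" "arity f = length as + length ts"
    and "\<forall>t\<in>set as. wf_tm F t"
  shows "Equal (Fn f (as @ ts)) (Fn f (as @ us)) \<in> \<Gamma>"
  using assms
proof (induction ts us arbitrary: as rule: list_all2_induct)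
  case Nil
  then show ?case by (auto intro: henkin_refl)
next
  case (Cons t ts u us)
  have wf: "wf_tm F t" "wf_tm F u" using henkin_wf[OF Cons.hyps(1)] by auto
  have wfs: "\<forall>t\<in>set ts. wf_tm F t"
    using Cons.hyps(2) henkin_wf by (fastforce simp: list_all2_conv_all_nth in_set_conv_nth)
  let ?c = "Fn f (map lift_tm as @ Var 0 # map lift_tm ts)"
  have "wf_tm F ?c" using Cons.prems wfs by auto
  from henkin_context[OF Cons.hyps(1) this]
  have "Equal (Fn f (as @ t # ts)) (Fn f (as @ u # ts)) \<in> \<Gamma>" by (simp add: comp_def)
  moreover have "Equal (Fn f ((as @ [u]) @ ts)) (Fn f ((as @ [u]) @ us)) \<in> \<Gamma>"
    using Cons.prems wf by (intro Cons.IH) auto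
  ultimately show ?case by (simp add: henkin_trans)
qed

text \<open>The elements are classes of terms modulo provable equality, numbered by
  \<open>to_nat_on\<close>. That numbering is onto the natural numbers only if there are infinitely
  many classes, which the assumption on numerals guarantees.\<close>

lemma henkin_model:
  assumes inf: "\<And>m n. m \<noteq> n \<Longrightarrow> Equal (numeral_tm m) (numeral_tm n) \<notin> \<Gamma>"
  shows "\<exists>M. \<forall>\<phi> e. wf_fm F \<phi> \<longrightarrow> fv \<phi> = {} \<longrightarrow> (sat M e \<phi> \<longleftrightarrow> \<phi> \<in> \<Gamma>)"
proof -
  define cl where "cl t = {u. Equal t u \<in> \<Gamma>}" for t
  define Q where "Q = cl ` {t. wf_tm F t}"
  define \<pi> where "\<pi> t = to_nat_on Q (cl t)" for t
  have cl_eq: "cl t = cl u \<longleftrightarrow> Equal t u \<in> \<Gamma>" if "wf_tm F t" "wf_tm F u" for t u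
    using that henkin_refl henkin_sym henkin_trans unfolding cl_def by blast
  have "inj (\<lambda>n. cl (numeral_tm n))"
    using inf cl_eq by (auto intro!: injI) (metis)
  then have "infinite (range (\<lambda>n. cl (numeral_tm n)))" by (simp add: finite_image_iff)
  moreover have "range (\<lambda>n. cl (numeral_tm n)) \<subseteq> Q" by (auto simp: Q_def)
  ultimately have "infinite Q" by (meson finite_subset)
  have "countable Q" unfolding Q_def by (intro countable_image) simp
  then have bij: "bij_betw (to_nat_on Q) Q UNIV" using \<open>infinite Q\<close> by (rule to_nat_on_infinite)
  have \<pi>_eq: "\<pi> t = \<pi> u \<longleftrightarrow> Equal t u \<in> \<Gamma>" if "wf_tm F t" "wf_tm F u" for t u
  proof -
    have "\<pi> t = \<pi> u \<longleftrightarrow> cl t = cl u"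
      using that bij unfolding \<pi>_def bij_betw_def by (auto simp: Q_def inj_on_eq_iff)
    then show ?thesis using cl_eq[OF that] by simp
  qed
  have "\<exists>t. wf_tm F t \<and> \<pi> t = n" for n
  proof -
    have "n \<in> to_nat_on Q ` Q" using bij by (simp add: bij_betw_def)
    then show ?thesis by (auto simp: Q_def \<pi>_def)
  qed
  \<comment> \<open>\<open>\<rho>\<close> picks a term for each element; an environment
    \<open>e\<close> then becomes the substitution of \<open>\<rho> (e i)\<close> for variable
    \<open>i\<close>.\<close>
  then obtain \<rho> where \<rho>: "wf_tm F (\<rho> n)" "\<pi> (\<rho> n) = n" for n by metis
  define M where "M = \<lparr>zr = \<pi> Zero, sc = (\<lambda>n. \<pi> (Succ (\<rho> n))),
    ad = (\<lambda>m n. \<pi> (Add (\<rho> m) (\<rho> n))), ml = (\<lambda>m n. \<pi> (Mul (\<rho> m) (\<rho> n))),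
    fn = (\<lambda>f ns. \<pi> (Fn f (map \<rho> ns)))\<rparr>"
  have \<rho>\<pi>: "Equal (\<rho> (\<pi> t)) t \<in> \<Gamma>" if "wf_tm F t" for t
    using \<pi>_eq[of "\<rho> (\<pi> t)" t] \<rho> that by simp
  let ?\<sigma> = "\<lambda>e i. \<rho> (e i)"
  have wf_\<sigma>: "wf_tm F (subst_tm (?\<sigma> e) t)" if "wf_tm F t" for e t
    using that \<rho> by (intro wf_subst_tm)
  have val: "val M e t = \<pi> (subst_tm (?\<sigma> e) t)" if "wf_tm F t" for e t
    using that
  proof (induction t)
    case (Succ t)
    let ?t = "subst_tm (?\<sigma> e) t"
    have "Equal (Succ (\<rho> (\<pi> ?t))) (Succ ?t) \<in> \<Gamma>"
      using henkin_context[OF \<rho>\<pi>, of ?t "Succ (Var 0)"] wf_\<sigma> Succ by simp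
    then show ?case using Succ wf_\<sigma> \<rho> by (simp add: M_def \<pi>_eq)
  next
    case (Add t u)
    let ?t = "subst_tm (?\<sigma> e) t" and ?u = "subst_tm (?\<sigma> e) u"
    have "Equal (Add (\<rho> (\<pi> ?t)) (\<rho> (\<pi> ?u))) (Add ?t (\<rho> (\<pi> ?u))) \<in> \<Gamma>"
      using henkin_context[OF \<rho>\<pi>, of ?t "Add (Var 0) (lift_tm (\<rho> (\<pi> ?u)))"] wf_\<sigma> Add \<rho> by simp
    moreover have "Equal (Add ?t (\<rho> (\<pi> ?u))) (Add ?t ?u) \<in> \<Gamma>"
      using henkin_context[OF \<rho>\<pi>, of ?u "Add (lift_tm ?t) (Var 0)"] wf_\<sigma> Add \<rho> by simp
    ultimately show ?case using Add wf_\<sigma> \<rho> henkin_trans by (auto simp: M_def \<pi>_eq)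
  next
    case (Mul t u)
    let ?t = "subst_tm (?\<sigma> e) t" and ?u = "subst_tm (?\<sigma> e) u"
    have "Equal (Mul (\<rho> (\<pi> ?t)) (\<rho> (\<pi> ?u))) (Mul ?t (\<rho> (\<pi> ?u))) \<in> \<Gamma>"
      using henkin_context[OF \<rho>\<pi>, of ?t "Mul (Var 0) (lift_tm (\<rho> (\<pi> ?u)))"] wf_\<sigma> Mul \<rho> by simp
    moreover have "Equal (Mul ?t (\<rho> (\<pi> ?u))) (Mul ?t ?u) \<in> \<Gamma>"
      using henkin_context[OF \<rho>\<pi>, of ?u "Mul (lift_tm ?t) (Var 0)"] wf_\<sigma> Mul \<rho> by simp
    ultimately show ?case using Mul wf_\<sigma> \<rho> henkin_trans by (auto simp: M_def \<pi>_eq)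
  next
    case (Fn f ts)
    let ?ts = "map (subst_tm (?\<sigma> e)) ts" and ?us = "map (\<lambda>t. \<rho> (\<pi> (subst_tm (?\<sigma> e) t))) ts"
    have "Equal (Fn f ([] @ ?us)) (Fn f ([] @ ?ts)) \<in> \<Gamma>"
      using Fn.prems \<rho>\<pi> wf_\<sigma>
      by (intro henkin_Fn) (auto simp: list_all2_conv_all_nth)
    moreover have "wf_tm F (Fn f ?us)" "wf_tm F (Fn f ?ts)" using Fn.prems \<rho> wf_\<sigma> by auto
    ultimately have "\<pi> (Fn f ?us) = \<pi> (Fn f ?ts)" using \<pi>_eq by simp
    moreover have "val M e (Fn f ts) = \<pi> (Fn f ?us)"
    proof -
      have "map (val M e) ts = map (\<lambda>t. \<pi> (subst_tm (?\<sigma> e) t)) ts" using Fn by simp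
      then have "val M e (Fn f ts) = fn M f (map (\<lambda>t. \<pi> (subst_tm (?\<sigma> e) t)) ts)"
        by (metis val.simps(6))
      then show ?thesis by (simp add: M_def comp_def)
    qed
    ultimately show ?case by simp
  qed (use \<rho> in \<open>simp_all add: M_def\<close>)
  have sat: "sat M e \<phi> \<longleftrightarrow> subst (?\<sigma> e) \<phi> \<in> \<Gamma>" if "wf_fm F \<phi>" for e \<phi>
    using that
  proof (induction \<phi> arbitrary: e)
    case (Equal t u)
    then show ?case using \<pi>_eq wf_\<sigma> by (simp add: val)
  next
    case Falsum
    then show ?case by (simp add: henkin_Falsum)
  next
    case (Conj \<phi> \<psi>)
    then show ?case by (simp add: henkin_Conj)
  next
    case (Disj \<phi> \<psi>)
    then show ?case using \<rho> by (simp add: henkin_Disj wf_subst)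
  next
    case (Impl \<phi> \<psi>)
    then show ?case using \<rho> by (simp add: henkin_Impl wf_subst)
  next
    case (Forall \<phi>)
    let ?\<chi> = "subst (up (?\<sigma> e)) \<phi>"
    have wf: "wf_fm F ?\<chi>" using Forall.prems \<rho> by (auto intro!: wf_subst wf_up)
    have cn: "?\<sigma> (case_nat n e) = case_nat (\<rho> n) (?\<sigma> e)" for n
      by (rule ext) (simp split: nat.split)
    have "sat M e (Forall \<phi>) \<longleftrightarrow> (\<forall>n. inst ?\<chi> (\<rho> n) \<in> \<Gamma>)"
      using Forall by (simp add: inst_subst_up cn)
    \<comment> \<open>Each term is equal in \<open>\<Gamma>\<close> to its chosen representative, so
      by Leibniz's law the representatives already give all instances.\<close>
    also have "\<dots> \<longleftrightarrow> (\<forall>t. wf_tm F t \<longrightarrow> inst ?\<chi> t \<in> \<Gamma>)"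
      using \<rho> henkin_Leibniz[OF \<rho>\<pi> _ wf] by blast
    finally show ?case using henkin_Forall[OF wf] by simp
  next
    case (Exists \<phi>)
    let ?\<chi> = "subst (up (?\<sigma> e)) \<phi>"
    have wf: "wf_fm F ?\<chi>" using Exists.prems \<rho> by (auto intro!: wf_subst wf_up)
    have cn: "?\<sigma> (case_nat n e) = case_nat (\<rho> n) (?\<sigma> e)" for n
      by (rule ext) (simp split: nat.split)
    have "sat M e (Exists \<phi>) \<longleftrightarrow> (\<exists>n. inst ?\<chi> (\<rho> n) \<in> \<Gamma>)"
      using Exists by (simp add: inst_subst_up cn)
    also have "\<dots> \<longleftrightarrow> (\<exists>t. wf_tm F t \<and> inst ?\<chi> t \<in> \<Gamma>)"
      using \<rho> henkin_Leibniz[OF henkin_sym[OF \<rho>\<pi>] _ wf] by blast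
    finally show ?case using henkin_Exists[OF wf] by simp
  qed
  have "subst (?\<sigma> e) \<phi> = \<phi>" if "fv \<phi> = {}" for e \<phi>
    using subst_cong[of \<phi> "?\<sigma> e" Var] that by simp
  then show ?thesis using sat by metis
qed

end

section \<open>The completeness theorem for theories containing PA\<close>

lemma fv_alls: "fv (alls n \<phi>) = {i. i + n \<in> fv \<phi>}"
  unfolding alls_def by (induction n) auto

lemma wf_alls [simp]: "wf_fm F (alls n \<phi>) = wf_fm F \<phi>"
  unfolding alls_def by (induction n) auto

text \<open>Supplies the infinity assumption of \<open>henkin_model\<close>. No model is at hand
  yet, so the two successor axioms are exploited by derivations in the calculus.\<close>

lemma PA_numerals_distinct:
  assumes ext: "extends F S (PA F)" and "m \<noteq> n"
  shows "deriv F S (Neg (Equal (numeral_tm m) (numeral_tm n)))"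
proof -
  have ax: "deriv F S \<phi>" if "\<phi> \<in> PA F" "wf_fm F \<phi>" for \<phi>
    using ext that unfolding extends_def by (blast intro: deriv.Assm)
  have S0: "deriv F S (Neg (Equal (Succ t) Zero))" if "wf_tm F t" for t
  proof -
    have "deriv F S (Forall (Neg (Equal (Succ (Var 0)) Zero)))"
      by (rule ax) (simp_all add: PA_def alls_def)
    from deriv.ForallE[OF this that] show ?thesis by simp
  qed
  have SS: "deriv F S (Impl (Equal (Succ (numeral_tm k)) (Succ (numeral_tm l)))
      (Equal (numeral_tm k) (numeral_tm l)))" for k l
  proof -
    have "deriv F S (Forall (Forall (Impl (Equal (Succ (Var 0)) (Succ (Var 1))) (Equal (Var 0) (Var 1)))))"
      by (rule ax) (simp_all add: PA_def alls_def numeral_2_eq_2)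
    from deriv.ForallE[OF this, of "numeral_tm l"]
    have "deriv F S (Forall (Impl (Equal (Succ (Var 0)) (Succ (numeral_tm l))) (Equal (Var 0) (numeral_tm l))))"
      by (simp add: inst_def)
    from deriv.ForallE[OF this, of "numeral_tm k"] show ?thesis by simp
  qed
  have sym: "deriv F \<Gamma> (Equal u t)" if "deriv F \<Gamma> (Equal t u)" for \<Gamma> t u
    using deriv.EqualE[OF that, of "Equal (Var 0) (lift_tm t)"] deriv.EqualI[of F t \<Gamma>]
      deriv_wf[OF that] by simp
  show ?thesis
    using \<open>m \<noteq> n\<close>
  proof (induction m n rule: diff_induct)
    case (1 m)
    then show ?case using S0 by (cases m) auto
  next
    case (2 n)
    let ?E = "Equal Zero (Succ (numeral_tm n))"
    have "deriv F (insert ?E S) ?E" by (rule deriv.Assm) auto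
    moreover have "deriv F (insert ?E S) (Neg (Equal (Succ (numeral_tm n)) Zero))"
      by (rule deriv_weaken[OF S0]) auto
    ultimately have "deriv F (insert ?E S) Falsum" using sym deriv.ImplE by blast
    then show ?case by (simp add: deriv.ImplI)
  next
    case (3 m n)
    let ?E = "Equal (Succ (numeral_tm m)) (Succ (numeral_tm n))"
    have "deriv F (insert ?E S) ?E" by (rule deriv.Assm) auto
    with deriv_weaken[OF SS] have "deriv F (insert ?E S) (Equal (numeral_tm m) (numeral_tm n))"
      using deriv.ImplE by (metis subset_insertI)
    moreover have "deriv F (insert ?E S) (Neg (Equal (numeral_tm m) (numeral_tm n)))"
      by (rule deriv_weaken[OF 3(1)]) (use 3 in auto)
    ultimately have "deriv F (insert ?E S) Falsum" using deriv.ImplE by blast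
    then show ?case by (simp add: deriv.ImplI)
  qed
qed

text \<open>The universal closure makes the refuted set consist of sentences, which leaves all
  variables free to act as witnesses.\<close>

theorem completeness:
  assumes S: "is_theory F S" "extends F S (PA F)" and \<theta>: "wf_fm F \<theta>" "fv \<theta> \<subseteq> {..<n}"
    and valid: "\<And>M e. models M S \<Longrightarrow> sat M e \<theta>"
  shows "deriv F S (alls n \<theta>)"
proof (rule ccontr)
  assume nd: "\<not> deriv F S (alls n \<theta>)"
  let ?\<theta> = "alls n \<theta>"
  have fv: "fv ?\<theta> = {}" using \<theta>(2) by (auto simp: fv_alls)
  have 1: "consistent F (insert (Neg ?\<theta>) S)"
    unfolding consistent_def using nd \<theta>(1) deriv.Classical wf_alls by blast
  have 2: "\<forall>\<gamma>\<in>insert (Neg ?\<theta>) S. wf_fm F \<gamma>" using S \<theta> by (auto simp: is_theory_def)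
  have 3: "finite (\<Union>\<gamma>\<in>insert (Neg ?\<theta>) S. fv \<gamma>)"
    using S fv by (auto simp: is_theory_def)
  from henkin_extension[OF 1 2 3]
  obtain \<Delta> where \<Delta>: "insert (Neg ?\<theta>) S \<subseteq> \<Delta>" "complete_henkin F \<Delta>" by blast
  have "Equal (numeral_tm k) (numeral_tm l) \<notin> \<Delta>" if "k \<noteq> l" for k l
  proof -
    have "deriv F \<Delta> (Neg (Equal (numeral_tm k) (numeral_tm l)))"
      by (rule deriv_weaken[OF PA_numerals_distinct[OF S(2) that]]) (use \<Delta> in blast)
    from henkin_closed[OF \<Delta>(2) this] show ?thesis by (simp add: henkin_Neg[OF \<Delta>(2)])
  qed
  then obtain M where M: "sat M e \<phi> \<longleftrightarrow> \<phi> \<in> \<Delta>" if "wf_fm F \<phi>" "fv \<phi> = {}" for e \<phi>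
    using henkin_model[OF \<Delta>(2)] by metis
  have "models M S" using M S \<Delta> by (auto simp: models_def is_theory_def)
  then have "\<forall>e. sat M e ?\<theta>" using valid all_sat_alls by blast
  moreover have "sat M e (Neg ?\<theta>)" for e using M[of "Neg ?\<theta>" e] \<theta> \<Delta> fv by simp
  ultimately show False by simp
qed


section \<open>Models of Peano arithmetic\<close>

lemma wf_tm_lift_tm_iff [simp]: "wf_tm F (lift_tm t) = wf_tm F t"
  using wf_lift_tm wf_lift_tmD by blast

lemma wf_leq [simp]: "wf_fm F (leq t u) \<longleftrightarrow> wf_tm F t \<and> wf_tm F u"
  and wf_lt [simp]: "wf_fm F (lt t u) \<longleftrightarrow> wf_tm F t \<and> wf_tm F u"
  by (simp_all add: leq_def lt_def)

lemma wf_defining_axioms: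
  assumes "admissible F" "f \<in> F" "\<phi> \<in> defining_axioms f"
  shows "wf_fm F \<phi>"
proof -
  have "wf_pf f" "constituents f \<subseteq> F" using assms(1,2) by (auto simp: admissible_def)
  then show ?thesis using assms(2,3) by (cases f) (auto simp: Let_def)
qed

lemma wf_induction_fm: "wf_fm F \<phi> \<Longrightarrow> wf_fm F (induction_fm \<phi>)"
  unfolding induction_fm_def by (auto intro!: wf_subst split: nat.split)

lemma wf_PA:
  assumes "admissible F" "\<phi> \<in> PA F"
  shows "wf_fm F \<phi>"
  using assms by (auto simp: PA_def wf_defining_axioms wf_induction_fm)

lemma models_PA:
  assumes "admissible F" "extends F S (PA F)" "models M S"
  shows "models M (PA F)"
  unfolding models_def
proof (intro ballI allI)
  fix \<phi> e assume "\<phi> \<in> PA F"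
  then have "deriv F (PA F) \<phi>" using wf_PA[OF assms(1)] by (intro deriv.Assm)
  then have "deriv F S \<phi>" using assms(2) by (simp add: extends_def)
  then show "sat M e \<phi>" by (rule models_deriv[OF assms(3)])
qed

lemma alls_inject [simp]: "alls n \<phi> = alls n \<psi> \<longleftrightarrow> \<phi> = \<psi>"
  unfolding alls_def by (induction n) auto

lemma arity_pair_pf [simp]: "arity pair_pf = 2"
  by (simp add: pair_pf_def)

lemma arity_const_pf [simp]: "arity (const_pf n k) = n"
  by (cases k) simp_all

lemma arity_num_pf [simp]: "arity num_pf = 1"
  by (simp add: num_pf_def)

lemma wf_list_tm: "pair_pf \<in> F \<Longrightarrow> \<forall>t\<in>set ts. wf_tm F t \<Longrightarrow> wf_tm F (list_tm ts)"
  by (induction ts) auto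

lemma wf_dot_tm: "admissible F \<Longrightarrow> wf_tm F (dot_tm k t)"
  by (induction t) (auto simp: admissible_def intro!: wf_list_tm)

lemma wf_dot_fm: "admissible F \<Longrightarrow> wf_tm F (dot_fm k \<phi>)"
  by (induction \<phi> arbitrary: k) (auto simp: admissible_def wf_dot_tm)

lemma wf_dot_quote: "admissible F \<Longrightarrow> wf_tm F (dot_quote \<phi>)"
  by (simp add: dot_quote_def wf_dot_fm)

lemma fv_numeral_tm [simp]: "fv_tm (numeral_tm n) = {}"
  by (induction n) auto

lemma fv_list_tm [simp]: "fv_tm (list_tm ts) = (\<Union>t\<in>set ts. fv_tm t)"
  by (induction ts) auto

lemma fv_dot_tm: "fv_tm (dot_tm k t) \<subseteq> {i. i + k \<in> fv_tm t}"
  by (induction t) auto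

lemma fv_dot_fm: "fv_tm (dot_fm k \<phi>) \<subseteq> {i. i + k \<in> fv \<phi>}"
proof (induction \<phi> arbitrary: k)
  case (Equal t u)
  then show ?case using fv_dot_tm by auto
next
  case (Forall \<phi>)
  then show ?case using Forall[of "Suc k"] by (simp add: subset_iff)
next
  case (Exists \<phi>)
  then show ?case using Exists[of "Suc k"] by (simp add: subset_iff)
qed (auto simp: subset_iff)

lemma fv_subst_tm: "fv_tm (subst_tm \<sigma> t) = (\<Union>i\<in>fv_tm t. fv_tm (\<sigma> i))"
  by (induction t) auto

lemma fv_subst: "fv (subst \<sigma> \<phi>) \<subseteq> (\<Union>i\<in>fv \<phi>. fv_tm (\<sigma> i))"
proof (induction \<phi> arbitrary: \<sigma>)
  case (Equal t u)
  then show ?case by (simp add: fv_subst_tm)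
next
  case (Forall \<phi>)
  have "i \<in> (\<Union>i\<in>fv (Forall \<phi>). fv_tm (\<sigma> i))" if "Suc i \<in> fv_tm (up \<sigma> j)" "j \<in> fv \<phi>" for i j
    using that by (cases j) (auto simp: lift_tm_def fv_subst_tm)
  then show ?case using Forall[of "up \<sigma>"] by fastforce
next
  case (Exists \<phi>)
  have "i \<in> (\<Union>i\<in>fv (Exists \<phi>). fv_tm (\<sigma> i))" if "Suc i \<in> fv_tm (up \<sigma> j)" "j \<in> fv \<phi>" for i j
    using that by (cases j) (auto simp: lift_tm_def fv_subst_tm)
  then show ?case using Exists[of "up \<sigma>"] by fastforce
qed (simp; blast)+

lemma fv_inst: "fv (inst \<phi> t) \<subseteq> fv_tm t \<union> {i. Suc i \<in> fv \<phi>}"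
proof -
  have "fv_tm (case_nat t Var i) \<subseteq> fv_tm t \<union> {i. Suc i \<in> fv \<phi>}" if "i \<in> fv \<phi>" for i
    using that by (cases i) auto
  then show ?thesis unfolding inst_def using fv_subst[of "case_nat t Var" \<phi>] by blast
qed

section \<open>Arithmetic inside a model\<close>

text \<open>The facts below are used in two roles: in the fixed model \<open>M\<close> where the
  argument takes place, and in an arbitrary model \<open>M'\<close> to show that an implication
  between formulas follows from PA.\<close>

locale pa_model =
  fixes F M
  assumes admissible: "admissible F" and models_PA: "models M (PA F)"
begin

lemma sat_axiom: "alls n \<phi> \<in> PA F \<Longrightarrow> sat M e \<phi>"
  using models_PA all_sat_alls unfolding models_def by blast

lemma sc_neq_zr [simp]: "sc M a \<noteq> zr M" "zr M \<noteq> sc M a"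
proof -
  have "sat M (\<lambda>_. a) (Neg (Equal (Succ (Var 0)) Zero))"
    by (rule sat_axiom[of 1]) (simp add: PA_def)
  then show "sc M a \<noteq> zr M" "zr M \<noteq> sc M a" by auto
qed

lemma sc_inject [simp]: "sc M a = sc M b \<longleftrightarrow> a = b"
proof -
  have "sat M (case_nat a (\<lambda>_. b)) (Impl (Equal (Succ (Var 0)) (Succ (Var 1))) (Equal (Var 0) (Var 1)))"
    by (rule sat_axiom[of 2]) (simp add: PA_def)
  then show ?thesis by auto
qed

lemma ad_zr [simp]: "ad M a (zr M) = a"
proof -
  have "sat M (\<lambda>_. a) (Equal (Add (Var 0) Zero) (Var 0))"
    by (rule sat_axiom[of 1]) (simp add: PA_def)
  then show ?thesis by auto
qed

lemma ad_sc [simp]: "ad M a (sc M b) = sc M (ad M a b)"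
proof -
  have "sat M (case_nat a (\<lambda>_. b)) (Equal (Add (Var 0) (Succ (Var 1))) (Succ (Add (Var 0) (Var 1))))"
    by (rule sat_axiom[of 2]) (simp add: PA_def)
  then show ?thesis by auto
qed

lemma ml_zr [simp]: "ml M a (zr M) = zr M"
proof -
  have "sat M (\<lambda>_. a) (Equal (Mul (Var 0) Zero) Zero)"
    by (rule sat_axiom[of 1]) (simp add: PA_def)
  then show ?thesis by auto
qed

lemma ml_sc [simp]: "ml M a (sc M b) = ad M (ml M a b) a"
proof -
  have "sat M (case_nat a (\<lambda>_. b))
      (Equal (Mul (Var 0) (Succ (Var 1))) (Add (Mul (Var 0) (Var 1)) (Var 0)))"
    by (rule sat_axiom[of 2]) (simp add: PA_def)
  then show ?thesis by auto
qed

lemma sat_defining_axiom: "f \<in> F \<Longrightarrow> alls n \<phi> \<in> defining_axioms f \<Longrightarrow> sat M e \<phi>"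
  by (rule sat_axiom) (auto simp: PA_def)

lemma map_nth_Cons_upt: "map (\<lambda>i. (x # xs) ! i) [Suc 0..<Suc (length xs)] = xs"
  by (simp add: map_Suc_upt[symmetric] comp_def map_nth del: upt_Suc)

lemma fn_PZero: "PZero n \<in> F \<Longrightarrow> length xs = n \<Longrightarrow> fn M (PZero n) xs = zr M"
  using sat_defining_axiom[of "PZero n" n _ "\<lambda>i. xs ! i"]
  by (auto simp: comp_def map_nth)

lemma fn_PSucc: "PSucc \<in> F \<Longrightarrow> fn M PSucc [a] = sc M a"
  using sat_defining_axiom[of PSucc 1 _ "\<lambda>i. a"] by auto

lemma fn_PProj: "PProj n i \<in> F \<Longrightarrow> length xs = n \<Longrightarrow> fn M (PProj n i) xs = xs ! i"
  using sat_defining_axiom[of "PProj n i" n _ "\<lambda>i. xs ! i"]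
  by (auto simp: comp_def map_nth)

lemma fn_PComp:
  "PComp n g hs \<in> F \<Longrightarrow> length xs = n \<Longrightarrow>
    fn M (PComp n g hs) xs = fn M g (map (\<lambda>h. fn M h xs) hs)"
  using sat_defining_axiom[of "PComp n g hs" n _ "\<lambda>i. xs ! i"]
  by (auto simp: comp_def map_nth)

lemma fn_PRec_zr:
  "PRec g h \<in> F \<Longrightarrow> length xs = arity g \<Longrightarrow> fn M (PRec g h) (zr M # xs) = fn M g xs"
  using map_nth[of xs] sat_defining_axiom[of "PRec g h" "arity g"
      "Equal (Fn (PRec g h) (Zero # map Var [0..<arity g])) (Fn g (map Var [0..<arity g]))" "\<lambda>i. xs ! i"]
  by (simp add: comp_def Let_def)

lemma fn_PRec_sc:
  assumes "PRec g h \<in> F" "length xs = arity g"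
  shows "fn M (PRec g h) (sc M a # xs) = fn M h (a # fn M (PRec g h) (a # xs) # xs)"
proof -
  let ?ys = "map Var [1..<Suc (arity g)]"
  have "sat M (\<lambda>i. (a # xs) ! i) (Equal (Fn (PRec g h) (Succ (Var 0) # ?ys))
                           (Fn h (Var 0 # Fn (PRec g h) (Var 0 # ?ys) # ?ys)))"
    by (rule sat_defining_axiom[OF assms(1), of "Suc (arity g)"]) (simp add: Let_def)
  then show ?thesis
    using map_nth_Cons_upt[of a xs] assms(2) by (simp add: comp_def del: upt_Suc)
qed

text \<open>The environment \<open>e\<close> carries arbitrary elements as parameters. Since
  \<open>\<theta>\<close> sees only finitely many of them, some \<open>alls n\<close> closes the
  induction formula and makes it an axiom.\<close>

lemma pa_induct:
  assumes "wf_fm F \<theta>" and "sat M (case_nat (zr M) e) \<theta>"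
    and "\<And>a. sat M (case_nat a e) \<theta> \<Longrightarrow> sat M (case_nat (sc M a) e) \<theta>"
  shows "sat M (case_nat a e) \<theta>"
proof -
  have "finite (fv (Forall \<theta>))" by (rule finite_fv)
  then obtain n where "\<forall>i\<in>fv (Forall \<theta>). i < n" using finite_nat_set_iff_bounded by blast
  then have "alls n (induction_fm \<theta>) \<in> PA F" using assms(1) unfolding PA_def by blast
  then have "sat M e (induction_fm \<theta>)" by (rule sat_axiom)
  moreover have "(\<lambda>i. val M (case_nat b e) (case_nat (Succ (Var 0)) (\<lambda>i. Var (Suc i)) i)) =
      case_nat (sc M b) e" for b
    by (rule ext) (simp split: nat.split)
  ultimately show ?thesis using assms(2,3) by (simp add: induction_fm_def sat_inst sat_subst)
qed

lemma zr_ad [simp]: "ad M (zr M) a = a"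
  using pa_induct[of "Equal (Add Zero (Var 0)) (Var 0)" "\<lambda>_. a" a] by simp

lemma sc_ad [simp]: "ad M (sc M a) b = sc M (ad M a b)"
  using pa_induct[of "Equal (Add (Succ (Var 1)) (Var 0)) (Succ (Add (Var 1) (Var 0)))" "\<lambda>_. a" b]
  by simp

lemma ad_assoc: "ad M (ad M a b) c = ad M a (ad M b c)"
  using pa_induct[of "Equal (Add (Add (Var 1) (Var 2)) (Var 0)) (Add (Var 1) (Add (Var 2) (Var 0)))"
    "case_nat a (\<lambda>_. b)" c]
  by (simp add: numeral_2_eq_2)

lemma ad_right_cancel: "ad M b a = ad M c a \<Longrightarrow> b = c"
  using pa_induct[of "Impl (Equal (Add (Var 1) (Var 0)) (Add (Var 2) (Var 0))) (Equal (Var 1) (Var 2))"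
    "case_nat b (\<lambda>_. c)" a]
  by (simp add: numeral_2_eq_2)

lemma zr_or_sc: "a = zr M \<or> (\<exists>b. a = sc M b)"
  using pa_induct[of "Disj (Equal (Var 0) Zero) (Exists (Equal (Var 1) (Succ (Var 0))))" "\<lambda>_. a" a]
  by simp

section \<open>The order of a model\<close>

definition le :: "nat \<Rightarrow> nat \<Rightarrow> bool" where
  "le a b \<longleftrightarrow> (\<exists>y. ad M y a = b)"

lemma sat_leq: "sat M e (leq t u) \<longleftrightarrow> le (val M e t) (val M e u)"
  and sat_lt: "sat M e (lt t u) \<longleftrightarrow> le (sc M (val M e t)) (val M e u)"
  by (simp_all add: leq_def lt_def le_def lift_tm_def val_subst)

lemma le_sc_sc [simp]: "le (sc M a) (sc M b) \<longleftrightarrow> le a b"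
  by (simp add: le_def)

lemma not_le_sc_zr [simp]: "\<not> le (sc M a) (zr M)"
  by (simp add: le_def)

text \<open>Either the difference is zero or it is a successor. Together with
  \<open>le_sc_sc\<close> this splits \<open>x < s(a)\<close> into \<open>x < a\<close> and
  \<open>x = a\<close>, the step of every induction on a bound.\<close>

lemma le_iff: "le a b \<longleftrightarrow> a = b \<or> le (sc M a) b"
proof
  assume "le a b"
  then obtain y where y: "ad M y a = b" by (auto simp: le_def)
  from zr_or_sc[of y] show "a = b \<or> le (sc M a) b"
  proof
    assume "y = zr M"
    then show ?thesis using y by simp
  next
    assume "\<exists>z. y = sc M z"
    then obtain z where "y = sc M z" by blast
    then have "ad M z (sc M a) = b" using y by simp
    then show ?thesis unfolding le_def by blast
  qed
next
  assume "a = b \<or> le (sc M a) b"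
  then show "le a b"
  proof
    assume "a = b"
    then have "ad M (zr M) a = b" by simp
    then show ?thesis unfolding le_def by blast
  next
    assume "le (sc M a) b"
    then obtain y where "ad M y (sc M a) = b" unfolding le_def by blast
    then have "ad M (sc M y) a = b" by simp
    then show ?thesis unfolding le_def by blast
  qed
qed

lemma le_total: "le a b \<or> le (sc M b) a"
proof -
  have "sat M (case_nat a (\<lambda>_. b)) (Disj (leq (Var 0) (Var 1)) (lt (Var 1) (Var 0)))"
  proof (rule pa_induct)
    have "le (zr M) b" unfolding le_def using ad_zr by blast
    then show "sat M (case_nat (zr M) (\<lambda>_. b)) (Disj (leq (Var 0) (Var 1)) (lt (Var 1) (Var 0)))"
      by (simp add: sat_leq)
  next
    fix a assume "sat M (case_nat a (\<lambda>_. b)) (Disj (leq (Var 0) (Var 1)) (lt (Var 1) (Var 0)))"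
    then show "sat M (case_nat (sc M a) (\<lambda>_. b)) (Disj (leq (Var 0) (Var 1)) (lt (Var 1) (Var 0)))"
      using le_iff[of a b] le_iff[of "sc M b" "sc M a"] le_iff[of b a]
      by (auto simp: sat_leq sat_lt)
  qed simp
  then show ?thesis by (simp add: sat_leq sat_lt)
qed

lemma le_sc_not_le: "le (sc M b) a \<Longrightarrow> \<not> le a b"
proof
  assume "le (sc M b) a" "le a b"
  then obtain y z where "ad M y (sc M b) = a" "ad M z a = b" by (auto simp: le_def)
  then have "ad M (sc M (ad M y z)) a = ad M (zr M) a" by (simp add: ad_assoc)
  then show False using ad_right_cancel by (metis sc_neq_zr(1))
qed

lemma not_le_iff: "\<not> le a b \<longleftrightarrow> le (sc M b) a"
  using le_total le_sc_not_le by blast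

lemma neq_iff_le: "a \<noteq> b \<longleftrightarrow> le (sc M a) b \<or> le (sc M b) a"
  using le_iff le_sc_not_le le_total by metis

section \<open>Standard elements and the function symbols\<close>

abbreviation num :: "nat \<Rightarrow> nat" where
  "num n \<equiv> (sc M ^^ n) (zr M)"

lemma val_numeral_tm [simp]: "val M e (numeral_tm n) = num n"
  by (induction n) simp_all

lemma num_add: "num (m + n) = ad M (num m) (num n)"
  by (induction n) simp_all

lemma num_mult: "num (m * n) = ml M (num m) (num n)"
proof (induction n)
  case (Suc n)
  have "num (m * Suc n) = num (m * n + m)" by (simp add: add.commute)
  then show ?case using Suc by (simp add: num_add)
qed simp

lemma constituents_in: "f \<in> F \<Longrightarrow> g \<in> constituents f \<Longrightarrow> g \<in> F"
  and wf_pf_in: "f \<in> F \<Longrightarrow> wf_pf f"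
  using admissible by (auto simp: admissible_def)

text \<open>At standard arguments the defining equations compute the actual value, even if the model
  is nonstandard. Through \<open>val_num\<close> this identifies the code of a sentence in the model
  with its real Goedel number.\<close>

lemma fn_num: "f \<in> F \<Longrightarrow> length ns = arity f \<Longrightarrow> fn M f (map num ns) = num (peval f ns)"
proof (induction f arbitrary: ns)
  case (PZero n)
  then show ?case by (simp add: fn_PZero)
next
  case PSucc
  then obtain n where "ns = [n]" by (auto simp: length_Suc_conv)
  then show ?case using PSucc by (simp add: fn_PSucc)
next
  case (PProj n i)
  then show ?case using wf_pf_in[of "PProj n i"] by (simp add: fn_PProj)
next
  case (PComp n g hs)
  have "g \<in> F" "set hs \<subseteq> F" using constituents_in[OF PComp.prems(1)] by auto
  moreover have "length hs = arity g" "\<forall>h\<in>set hs. arity h = n"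
    using wf_pf_in[OF PComp.prems(1)] by auto
  ultimately have "fn M g (map num (map (\<lambda>h. peval h ns) hs)) = num (peval g (map (\<lambda>h. peval h ns) hs))"
    and "map (\<lambda>h. fn M h (map num ns)) hs = map num (map (\<lambda>h. peval h ns) hs)"
    using PComp.prems PComp.IH(1)[of "map (\<lambda>h. peval h ns) hs"] by (auto simp: PComp.IH(2))
  then show ?case
    using PComp.prems fn_PComp[of n g hs "map num ns"] by (metis length_map peval.simps(4) arity.simps(4))
next
  case (PRec g h)
  have F: "g \<in> F" "h \<in> F" "arity h = arity g + 2"
    using constituents_in[OF PRec.prems(1)] wf_pf_in[OF PRec.prems(1)] by auto
  from PRec.prems obtain x xs where ns: "ns = x # xs" and len: "length xs = arity g"
    by (auto simp: length_Suc_conv)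
  have "fn M (PRec g h) (map num (x # xs)) = num (peval (PRec g h) (x # xs))"
  proof (induction x)
    case 0
    then show ?case using PRec.prems(1) PRec.IH(1)[OF F(1) len] len by (simp add: fn_PRec_zr)
  next
    case (Suc x)
    let ?r = "peval (PRec g h) (x # xs)"
    have "fn M (PRec g h) (map num (Suc x # xs)) = fn M h (num x # fn M (PRec g h) (num x # map num xs) # map num xs)"
      using fn_PRec_sc[OF PRec.prems(1), of "map num xs" "num x"] len by simp
    also have "\<dots> = fn M h (map num (x # ?r # xs))" using Suc by simp
    also have "\<dots> = num (peval h (x # ?r # xs))" using F len by (intro PRec.IH) auto
    finally show ?case by simp
  qed
  then show ?case using ns by simp
qed

lemma val_num: "wf_tm F t \<Longrightarrow> val M (\<lambda>i. num (e i)) t = num (eval_tm e t)"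
proof (induction t)
  case (Fn f ts)
  then have "map (val M (\<lambda>i. num (e i))) ts = map num (map (eval_tm e) ts)" by simp
  then have "val M (\<lambda>i. num (e i)) (Fn f ts) = fn M f (map num (map (eval_tm e) ts))"
    by (metis val.simps(6))
  then show ?case using Fn.prems fn_num[of f "map (eval_tm e) ts"] by simp
qed (simp_all add: num_add num_mult)

lemma fn_const_pf: "const_pf n k \<in> F \<Longrightarrow> length xs = n \<Longrightarrow> fn M (const_pf n k) xs = num k"
proof (induction k)
  case (Suc k)
  then have "const_pf n k \<in> F" "PSucc \<in> F" using constituents_in[OF Suc.prems(1)] by auto
  then show ?case using Suc by (simp add: fn_PComp fn_PSucc)
qed (simp add: fn_PZero)

lemma num_pf_in: "num_pf \<in> F"
  using admissible by (simp add: admissible_def)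

lemma num_pf_zr: "fn M num_pf [zr M] = num (gn_tm Zero)"
  using fn_num[OF num_pf_in, of "[0]"] by (simp add: num_pf_def)

text \<open>Valid for nonstandard \<open>a\<close> as well, since it is the recursion equation
  itself. The number 2 is the tag of \<open>Succ\<close> in \<open>gn_tm\<close>, so the right-hand
  side is how a dotted term codes the successor of a variable with value \<open>a\<close>.\<close>

lemma num_pf_sc: "fn M num_pf [sc M a] = fn M pair_pf [num 2, fn M num_pf [a]]"
proof -
  let ?g = "const_pf 0 (gn_tm Zero)" and ?h = "PComp 2 pair_pf [const_pf 2 2, PProj 2 1]"
  have F: "PRec ?g ?h \<in> F" using num_pf_in by (simp add: num_pf_def)
  then have h: "?h \<in> F" using constituents_in by fastforce
  then have "const_pf 2 2 \<in> F" "PProj 2 1 \<in> F" using constituents_in[OF h] by auto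
  then show ?thesis
    using fn_PRec_sc[OF F, of "[]" a] fn_PComp[OF h] fn_const_pf[of 2 2] fn_PProj[of 2 1]
    by (simp add: num_pf_def)
qed


section \<open>Codes of formulas with parameters from the model\<close>

definition dot_val :: "(nat \<Rightarrow> nat) \<Rightarrow> fm \<Rightarrow> nat" where
  "dot_val e \<phi> = val M e (dot_quote \<phi>)"

lemma dot_tm_lift: "dot_tm k (subst_tm (\<lambda>j. Var (j + k)) t) = dot_tm 0 t"
  by (induction t) (simp_all cong: map_cong)

lemma val_list_tm:
  "map (val M e) ts = map (val M e') us \<Longrightarrow> val M e (list_tm ts) = val M e' (list_tm us)"
proof (induction ts arbitrary: us)
  case (Cons t ts)
  then show ?case by (cases us) auto
qed simp

lemma val_dot_tm_subst:
  assumes "\<And>i. i \<in> fv_tm t \<Longrightarrow> i < k \<Longrightarrow> \<sigma> i = Var i"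
    and "\<And>i. i + k \<in> fv_tm t \<Longrightarrow> val M e (dot_tm k (\<sigma> (i + k))) = fn M num_pf [e' i]"
  shows "val M e (dot_tm k (subst_tm \<sigma> t)) = val M e' (dot_tm k t)"
  using assms
proof (induction t)
  case (Var i)
  show ?case using Var(1)[of i] Var(2)[of "i - k"] by (cases "i < k") simp_all
next
  case (Fn f ts)
  have "val M e (dot_tm k (subst_tm \<sigma> t)) = val M e' (dot_tm k t)" if "t \<in> set ts" for t
    using that Fn.prems by (intro Fn.IH) auto
  then have "val M e (list_tm (map (dot_tm k) (map (subst_tm \<sigma>) ts))) =
      val M e' (list_tm (map (dot_tm k) ts))"
    by (intro val_list_tm) simp
  then show ?case by simp
qed auto

text \<open>Under \<open>k\<close> quantifiers the lower indices are bound and must stay fixed,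
  while a term inserted for a free variable has been shifted by \<open>k\<close>. By
  \<open>dot_tm_lift\<close> the shift does not change its code, which makes the hypothesis stable
  under \<open>up\<close>.\<close>

lemma val_dot_fm_subst:
  assumes "\<And>i. i \<in> fv \<phi> \<Longrightarrow> i < k \<Longrightarrow> \<sigma> i = Var i"
    and "\<And>i. i + k \<in> fv \<phi> \<Longrightarrow>
      \<exists>t. \<sigma> (i + k) = subst_tm (\<lambda>j. Var (j + k)) t \<and> val M e (dot_tm 0 t) = fn M num_pf [e' i]"
  shows "val M e (dot_fm k (subst \<sigma> \<phi>)) = val M e' (dot_fm k \<phi>)"
  using assms
proof (induction \<phi> arbitrary: k \<sigma>)
  case (Equal t u)
  have "val M e (dot_tm k (\<sigma> (i + k))) = fn M num_pf [e' i]" if "i + k \<in> fv (Equal t u)" for i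
    using Equal.prems(2)[OF that] by (auto simp: dot_tm_lift)
  then show ?case using Equal.prems(1) by (simp add: val_dot_tm_subst)
next
  case (Forall \<phi>)
  have "val M e (dot_fm (Suc k) (subst (up \<sigma>) \<phi>)) = val M e' (dot_fm (Suc k) \<phi>)"
  proof (rule Forall.IH)
    show "up \<sigma> i = Var i" if "i \<in> fv \<phi>" "i < Suc k" for i
      using that Forall.prems(1) by (cases i) (auto simp: lift_tm_def)
  next
    fix i assume "i + Suc k \<in> fv \<phi>"
    then obtain t where "\<sigma> (i + k) = subst_tm (\<lambda>j. Var (j + k)) t"
      "val M e (dot_tm 0 t) = fn M num_pf [e' i]"
      using Forall.prems(2)[of i] by auto
    then show "\<exists>t. up \<sigma> (i + Suc k) = subst_tm (\<lambda>j. Var (j + Suc k)) t \<and>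
        val M e (dot_tm 0 t) = fn M num_pf [e' i]"
      by (intro exI[of _ t]) (simp add: lift_tm_def subst_tm_subst_tm)
  qed
  then show ?case by simp
next
  case (Exists \<phi>)
  have "val M e (dot_fm (Suc k) (subst (up \<sigma>) \<phi>)) = val M e' (dot_fm (Suc k) \<phi>)"
  proof (rule Exists.IH)
    show "up \<sigma> i = Var i" if "i \<in> fv \<phi>" "i < Suc k" for i
      using that Exists.prems(1) by (cases i) (auto simp: lift_tm_def)
  next
    fix i assume "i + Suc k \<in> fv \<phi>"
    then obtain t where "\<sigma> (i + k) = subst_tm (\<lambda>j. Var (j + k)) t"
      "val M e (dot_tm 0 t) = fn M num_pf [e' i]"
      using Exists.prems(2)[of i] by auto
    then show "\<exists>t. up \<sigma> (i + Suc k) = subst_tm (\<lambda>j. Var (j + Suc k)) t \<and>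
        val M e (dot_tm 0 t) = fn M num_pf [e' i]"
      by (intro exI[of _ t]) (simp add: lift_tm_def subst_tm_subst_tm)
  qed
  then show ?case by simp
next
  case (Conj \<phi> \<psi>)
  have "val M e (dot_fm k (subst \<sigma> \<phi>)) = val M e' (dot_fm k \<phi>)"
    "val M e (dot_fm k (subst \<sigma> \<psi>)) = val M e' (dot_fm k \<psi>)"
    using Conj.prems by (auto intro!: Conj.IH)
  then show ?case by simp
next
  case (Disj \<phi> \<psi>)
  have "val M e (dot_fm k (subst \<sigma> \<phi>)) = val M e' (dot_fm k \<phi>)"
    "val M e (dot_fm k (subst \<sigma> \<psi>)) = val M e' (dot_fm k \<psi>)"
    using Disj.prems by (auto intro!: Disj.IH)
  then show ?case by simp
next
  case (Impl \<phi> \<psi>)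
  have "val M e (dot_fm k (subst \<sigma> \<phi>)) = val M e' (dot_fm k \<phi>)"
    "val M e (dot_fm k (subst \<sigma> \<psi>)) = val M e' (dot_fm k \<psi>)"
    using Impl.prems by (auto intro!: Impl.IH)
  then show ?case by simp
qed simp

text \<open>
  The hypothesis says that \<open>\<sigma> i\<close> is coded like the numeral of \<open>e' i\<close>. It holds when \<open>\<sigma> i\<close> is a
  variable, \<open>0\<close>, or the successor of a variable, with \<open>e' i\<close> its value.
\<close>

lemma dot_val_subst:
  assumes "\<And>i. i \<in> fv \<phi> \<Longrightarrow> val M e (dot_tm 0 (\<sigma> i)) = fn M num_pf [e' i]"
  shows "dot_val e (subst \<sigma> \<phi>) = dot_val e' \<phi>"
  unfolding dot_val_def dot_quote_def by (rule val_dot_fm_subst) (use assms in auto)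

lemma dot_val_cong: "(\<And>i. i \<in> fv \<phi> \<Longrightarrow> e i = e' i) \<Longrightarrow> dot_val e \<phi> = dot_val e' \<phi>"
  using dot_val_subst[of \<phi> e Var e'] by simp

lemma dot_val_lift [simp]: "dot_val (case_nat a e) (lift \<phi>) = dot_val e \<phi>"
  unfolding lift_def by (rule dot_val_subst) simp

lemma dot_val_fresh [simp]: "i \<notin> fv \<phi> \<Longrightarrow> dot_val (e(i := a)) \<phi> = dot_val e \<phi>"
  by (rule dot_val_cong) auto

text \<open>Links \<open>D1\<close>, which speaks of \<open>quote\<close>, with \<open>B2U\<close>,
  which speaks of dotted terms. For a sentence the environment can be replaced by a standard one,
  where \<open>eval_dot_quote\<close> applies.\<close>

lemma dot_val_sentence:
  assumes "fv \<phi> = {}"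
  shows "dot_val e \<phi> = val M e (quote \<phi>)"
proof -
  have "dot_val e \<phi> = dot_val (\<lambda>i. num 0) \<phi>" using assms by (intro dot_val_cong) auto
  also have "\<dots> = num (eval_tm (\<lambda>i. 0) (dot_quote \<phi>))"
    unfolding dot_val_def by (rule val_num) (rule wf_dot_quote[OF admissible])
  also have "eval_tm (\<lambda>i. 0) (dot_quote \<phi>) = gn (subst (\<lambda>i. numeral_tm 0) \<phi>)"
    by (rule eval_dot_quote)
  also have "subst (\<lambda>i. numeral_tm 0) \<phi> = \<phi>"
    using subst_cong[of \<phi> "\<lambda>i. numeral_tm 0" Var] assms by simp
  finally show ?thesis by (simp add: quote_def)
qed

end

lemma val_fresh [simp]: "i \<notin> fv_tm t \<Longrightarrow> val M (e(i := a)) t = val M e t"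
  by (rule val_cong) auto

lemma sat_fresh [simp]: "i \<notin> fv \<phi> \<Longrightarrow> sat M (e(i := a)) \<phi> = sat M e \<phi>"
  by (rule sat_cong) auto

lemma subst_tm_fresh [simp]: "i \<notin> fv_tm t \<Longrightarrow> subst_tm (\<sigma>(i := u)) t = subst_tm \<sigma> t"
  by (rule subst_tm_cong) auto

lemma subst_fresh [simp]: "i \<notin> fv \<phi> \<Longrightarrow> subst (\<sigma>(i := u)) \<phi> = subst \<sigma> \<phi>"
  by (rule subst_cong) auto


section \<open>Provable completeness inside a model\<close>

text \<open>\<open>P_mono\<close> is the form in which \<open>B2U\<close> enters: provability of the
  implication is replaced by its truth in all models of PA, and \<open>e\<close> may assign
  nonstandard elements. The set \<open>P\<close> is definable by \<open>\<Phi>\<close>, which is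
  what makes induction about it available in \<open>M\<close>.\<close>

locale reflection = pa_model +
  fixes \<Phi> :: fm and P :: "nat \<Rightarrow> bool"
  assumes wf_\<Phi>: "wf_fm F \<Phi>"
    and P_iff: "\<And>a e. P a \<longleftrightarrow> sat M (case_nat a e) \<Phi>"
    and P_mono: "\<And>\<phi> \<psi> e. wf_fm F \<phi> \<Longrightarrow> wf_fm F \<psi> \<Longrightarrow>
      (\<And>M' e'. pa_model F M' \<Longrightarrow> sat M' e' \<phi> \<Longrightarrow> sat M' e' \<psi>) \<Longrightarrow>
      P (dot_val e \<phi>) \<Longrightarrow> P (dot_val e \<psi>)"
begin

section \<open>Reflected formulas and their closure properties\<close>

text \<open>Both formulas are coded in the same environment, so \<open>\<psi>\<close> can record
  facts about the elements that \<open>\<phi>\<close> speaks of.\<close>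

definition reflected :: "fm \<Rightarrow> bool" where
  "reflected \<phi> \<longleftrightarrow> wf_fm F \<phi> \<and>
     (\<forall>\<psi> e. wf_fm F \<psi> \<longrightarrow> sat M e \<phi> \<longrightarrow> P (dot_val e \<psi>) \<longrightarrow> P (dot_val e (Conj \<psi> \<phi>)))"

text \<open>Says that the value of \<open>t\<close> is known inside \<open>P\<close>, with variable
  \<open>j\<close> as its name. All \<open>j\<close> are allowed, also those occurring in
  \<open>t\<close>.\<close>

definition evaluated :: "tm \<Rightarrow> bool" where
  "evaluated t \<longleftrightarrow> (\<forall>j. reflected (Equal t (Var j)))"

lemma reflectedI:
  assumes "wf_fm F \<phi>"
    and "\<And>\<psi> e. wf_fm F \<psi> \<Longrightarrow> sat M e \<phi> \<Longrightarrow> P (dot_val e \<psi>) \<Longrightarrow> P (dot_val e (Conj \<psi> \<phi>))"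
  shows "reflected \<phi>"
  using assms unfolding reflected_def by blast

lemma reflectedD:
  "reflected \<phi> \<Longrightarrow> wf_fm F \<psi> \<Longrightarrow> sat M e \<phi> \<Longrightarrow> P (dot_val e \<psi>) \<Longrightarrow> P (dot_val e (Conj \<psi> \<phi>))"
  unfolding reflected_def by blast

lemma reflected_wf: "reflected \<phi> \<Longrightarrow> wf_fm F \<phi>"
  unfolding reflected_def by blast

lemma evaluated_wf: "evaluated t \<Longrightarrow> wf_tm F t"
  unfolding evaluated_def using reflected_wf by fastforce

lemma pa_model_self: "pa_model F M"
  by unfold_locales

lemma reflected_equiv:
  assumes "reflected \<phi>" "wf_fm F \<phi>'"
    and "\<And>M' e. pa_model F M' \<Longrightarrow> sat M' e \<phi>' \<longleftrightarrow> sat M' e \<phi>"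
  shows "reflected \<phi>'"
proof (rule reflectedI[OF assms(2)])
  fix \<psi> e assume \<psi>: "wf_fm F \<psi>" and "sat M e \<phi>'" "P (dot_val e \<psi>)"
  then have "P (dot_val e (Conj \<psi> \<phi>))"
    using reflectedD[OF assms(1)] assms(3) pa_model_self by simp
  then show "P (dot_val e (Conj \<psi> \<phi>'))"
    by (rule P_mono[rotated 3]) (use assms \<psi> reflected_wf in auto)
qed

text \<open>The strengthened claim pays off here: \<open>Conj \<psi> \<phi>\<close> becomes the side
  formula for \<open>\<phi>'\<close>.\<close>

lemma reflected_Conj:
  assumes "reflected \<phi>" "reflected \<phi>'"
  shows "reflected (Conj \<phi> \<phi>')"
proof (rule reflectedI)
  fix \<psi> e assume \<psi>: "wf_fm F \<psi>" and *: "sat M e (Conj \<phi> \<phi>')" "P (dot_val e \<psi>)"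
  have "P (dot_val e (Conj \<psi> \<phi>))" using reflectedD[OF assms(1) \<psi>] * by simp
  then have "P (dot_val e (Conj (Conj \<psi> \<phi>) \<phi>'))"
    using reflectedD[OF assms(2)] assms \<psi> * reflected_wf by simp
  then show "P (dot_val e (Conj \<psi> (Conj \<phi> \<phi>')))"
    by (rule P_mono[rotated 3]) (use assms \<psi> reflected_wf in auto)
qed (use assms reflected_wf in auto)

lemma reflected_Disj:
  assumes "reflected \<phi>" "reflected \<phi>'"
  shows "reflected (Disj \<phi> \<phi>')"
proof (rule reflectedI)
  fix \<psi> e assume \<psi>: "wf_fm F \<psi>" and *: "sat M e (Disj \<phi> \<phi>')" "P (dot_val e \<psi>)"
  then have "P (dot_val e (Conj \<psi> \<phi>)) \<or> P (dot_val e (Conj \<psi> \<phi>'))"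
    using reflectedD[OF assms(1) \<psi>] reflectedD[OF assms(2) \<psi>] by auto
  then show "P (dot_val e (Conj \<psi> (Disj \<phi> \<phi>')))"
  proof
    assume "P (dot_val e (Conj \<psi> \<phi>))"
    then show ?thesis by (rule P_mono[rotated 3]) (use assms \<psi> reflected_wf in auto)
  next
    assume "P (dot_val e (Conj \<psi> \<phi>'))"
    then show ?thesis by (rule P_mono[rotated 3]) (use assms \<psi> reflected_wf in auto)
  qed
qed (use assms reflected_wf in auto)

lemma env_split: "e = case_nat (e 0) (\<lambda>i. e (Suc i))"
  by (rule ext) (simp split: nat.split)

lemma sat_liftE: "sat M' e (lift \<phi>) \<longleftrightarrow> sat M' (\<lambda>i. e (Suc i)) \<phi>"
  by (simp add: lift_def sat_subst)

text \<open>The witness, possibly nonstandard, becomes the value of variable 0, while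
  \<open>lift \<psi>\<close> keeps the code of \<open>\<psi>\<close>. Weakening to a formula that
  does not mention variable 0 then removes the witness from the code.\<close>

lemma reflected_Exists:
  assumes "reflected \<phi>"
  shows "reflected (Exists \<phi>)"
proof (rule reflectedI)
  fix \<psi> e assume \<psi>: "wf_fm F \<psi>" and *: "sat M e (Exists \<phi>)" "P (dot_val e \<psi>)"
  then obtain a where a: "sat M (case_nat a e) \<phi>" by auto
  have "P (dot_val (case_nat a e) (lift \<psi>))" using * by simp
  then have "P (dot_val (case_nat a e) (Conj (lift \<psi>) \<phi>))"
    using reflectedD[OF assms] a \<psi> by simp
  then have "P (dot_val (case_nat a e) (lift (Conj \<psi> (Exists \<phi>))))"
  proof (rule P_mono[rotated 3])
    fix M' e' assume *: "sat M' e' (Conj (lift \<psi>) \<phi>)"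
    then have "sat M' (case_nat (e' 0) (\<lambda>i. e' (Suc i))) \<phi>" using env_split[of e'] by simp
    then show "sat M' e' (lift (Conj \<psi> (Exists \<phi>)))" using * by (auto simp: sat_liftE)
  qed (use assms \<psi> reflected_wf in auto)
  then show "P (dot_val e (Conj \<psi> (Exists \<phi>)))" by simp
qed (use assms reflected_wf in auto)

lemma ex_fresh: "finite A \<Longrightarrow> \<exists>N::nat. N \<notin> A"
  using ex_new_if_finite infinite_UNIV_nat by blast

text \<open>A fresh variable \<open>N\<close> is given the value of \<open>t\<close>, and the
  equation between them joins the side formula. In its presence \<open>\<phi>'\<close>, which speaks
  of \<open>N\<close>, entails \<open>\<phi>\<close>; afterwards \<open>N\<close> disappears from
  the formula and its value no longer matters.\<close>

lemma reflected_let: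
  assumes t: "evaluated t" and \<phi>: "wf_fm F \<phi>"
    and let_fm: "\<And>N. N \<notin> fv_tm t \<Longrightarrow> N \<notin> fv \<phi> \<Longrightarrow> \<exists>\<phi>'. reflected \<phi>' \<and>
      (\<forall>M' e. pa_model F M' \<longrightarrow> sat M' (e(N := val M' e t)) \<phi>' = sat M' e \<phi>)"
  shows "reflected \<phi>"
proof (rule reflectedI[OF \<phi>])
  fix \<psi> e assume \<psi>: "wf_fm F \<psi>" and *: "sat M e \<phi>" "P (dot_val e \<psi>)"
  obtain N where "N \<notin> fv_tm t \<union> fv \<phi> \<union> fv \<psi>" using ex_fresh by (meson finite_Un finite_fv finite_fv_tm)
  then have N: "N \<notin> fv_tm t" "N \<notin> fv \<phi>" "N \<notin> fv \<psi>" by auto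
  obtain \<phi>' where \<phi>': "reflected \<phi>'"
    "\<And>M' e. pa_model F M' \<Longrightarrow> sat M' (e(N := val M' e t)) \<phi>' = sat M' e \<phi>"
    using let_fm[OF N(1,2)] by blast
  let ?e = "e(N := val M e t)" and ?E = "Equal t (Var N)"
  have E: "reflected ?E" using t by (simp add: evaluated_def)
  have "P (dot_val ?e \<psi>)" using * N by simp
  then have "P (dot_val ?e (Conj \<psi> ?E))" using reflectedD[OF E \<psi>] N by simp
  then have "P (dot_val ?e (Conj (Conj \<psi> ?E) \<phi>'))"
    using reflectedD[OF \<phi>'(1), of "Conj \<psi> ?E" ?e] \<phi>'(2)[OF pa_model_self, of e] *(1) \<psi> evaluated_wf[OF t]
    by simp
  then have "P (dot_val ?e (Conj \<psi> \<phi>))"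
  proof (rule P_mono[rotated 3])
    fix M' e' assume pa: "pa_model F M'" and s: "sat M' e' (Conj (Conj \<psi> ?E) \<phi>')"
    then have "e'(N := val M' e' t) = e'" by auto
    then show "sat M' e' (Conj \<psi> \<phi>)" using \<phi>'(2)[OF pa, of e'] s by auto
  qed (use \<phi> \<psi> reflected_wf[OF \<phi>'(1)] evaluated_wf[OF t] in auto)
  moreover have "N \<notin> fv (Conj \<psi> \<phi>)" using N by simp
  ultimately show "P (dot_val e (Conj \<psi> \<phi>))" by (metis dot_val_fresh)
qed

section \<open>Evaluation of terms\<close>

lemma evaluated_cong:
  assumes "evaluated u" "wf_tm F t" "\<And>M' e. pa_model F M' \<Longrightarrow> val M' e t = val M' e u"
  shows "evaluated t"
  unfolding evaluated_def
proof
  fix j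
  have "reflected (Equal u (Var j))" using assms(1) by (simp add: evaluated_def)
  then show "reflected (Equal t (Var j))" by (rule reflected_equiv) (use assms in auto)
qed

text \<open>The equation \<open>Var i = Var i\<close> can be added by logic alone, and it has the
  same code as \<open>Var i = Var j\<close> because the two variables have the same value. The cases
  of zero and of the successor of a variable work alike, by \<open>num_pf_zr\<close> and
  \<open>num_pf_sc\<close>.\<close>

lemma evaluated_Var: "evaluated (Var i)"
  unfolding evaluated_def
proof (intro allI reflectedI)
  fix j \<psi> e assume \<psi>: "wf_fm F \<psi>" and *: "sat M e (Equal (Var i) (Var j))" "P (dot_val e \<psi>)"
  from *(2) have "P (dot_val e (Conj \<psi> (Equal (Var i) (Var i))))"
    by (rule P_mono[rotated 3]) (use \<psi> in auto)
  then show "P (dot_val e (Conj \<psi> (Equal (Var i) (Var j))))"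
    using *(1) by (simp add: dot_val_def dot_quote_def)
qed simp

lemma evaluated_Zero: "evaluated Zero"
  unfolding evaluated_def
proof (intro allI reflectedI)
  fix j \<psi> e assume \<psi>: "wf_fm F \<psi>" and *: "sat M e (Equal Zero (Var j))" "P (dot_val e \<psi>)"
  from *(2) have "P (dot_val e (Conj \<psi> (Equal Zero Zero)))"
    by (rule P_mono[rotated 3]) (use \<psi> in auto)
  moreover have "fn M num_pf [e j] = num (gn_tm Zero)" using *(1) num_pf_zr by simp
  ultimately show "P (dot_val e (Conj \<psi> (Equal Zero (Var j))))"
    by (simp add: dot_val_def dot_quote_def)
qed simp

lemma evaluated_Succ_Var: "evaluated (Succ (Var i))"
  unfolding evaluated_def
proof (intro allI reflectedI)
  fix j \<psi> e assume \<psi>: "wf_fm F \<psi>" and *: "sat M e (Equal (Succ (Var i)) (Var j))" "P (dot_val e \<psi>)"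
  from *(2) have "P (dot_val e (Conj \<psi> (Equal (Succ (Var i)) (Succ (Var i)))))"
    by (rule P_mono[rotated 3]) (use \<psi> in auto)
  moreover have "fn M num_pf [e j] = fn M pair_pf [num 2, fn M num_pf [e i]]"
    using *(1) num_pf_sc[of "e i"] by simp
  ultimately show "P (dot_val e (Conj \<psi> (Equal (Succ (Var i)) (Var j))))"
    by (simp add: dot_val_def dot_quote_def)
qed simp

lemma evaluated_Succ:
  assumes "evaluated t"
  shows "evaluated (Succ t)"
  unfolding evaluated_def
proof
  fix j
  show "reflected (Equal (Succ t) (Var j))"
  proof (rule reflected_let[OF assms])
    fix N assume "N \<notin> fv_tm t" "N \<notin> fv (Equal (Succ t) (Var j))"
    then show "\<exists>\<phi>'. reflected \<phi>' \<and> (\<forall>M' e. pa_model F M' \<longrightarrow>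
        sat M' (e(N := val M' e t)) \<phi>' = sat M' e (Equal (Succ t) (Var j)))"
      using evaluated_Succ_Var[of N]
      by (intro exI[of _ "Equal (Succ (Var N)) (Var j)"]) (auto simp: evaluated_def)
  qed (use evaluated_wf[OF assms] in simp)
qed

text \<open>Membership in \<open>P\<close> of a code given by a term is the single formula
  \<open>inst \<Phi> t\<close>, and so an instance of the induction scheme.\<close>

lemma P_induct:
  assumes "wf_tm F t" and "P (val M (case_nat (zr M) e) t)"
    and "\<And>a. P (val M (case_nat a e) t) \<Longrightarrow> P (val M (case_nat (sc M a) e) t)"
  shows "P (val M (case_nat a e) t)"
  using pa_induct[of "inst \<Phi> t" e a] assms wf_\<Phi> by (simp add: sat_inst P_iff[symmetric])


text \<open>The common pattern of addition, multiplication and \<open>PRec\<close>: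
  \<open>t N\<close> is defined by recursion on \<open>N\<close> with parameters in
  \<open>B\<close>, and \<open>h N K\<close> yields the next value from the argument
  \<open>N\<close> and the present value \<open>K\<close>. The induction over the recursion variable
  takes place in \<open>M\<close>, so it also reaches nonstandard arguments.\<close>

lemma evaluated_rec:
  assumes B: "finite B" "\<And>N. fv_tm (t N) \<subseteq> insert N B" "\<And>N K. fv_tm (h N K) \<subseteq> {N, K} \<union> B"
    and wf: "\<And>N. wf_tm F (t N)"
    and rename: "\<And>N i. N \<notin> B \<Longrightarrow> subst_tm (Var(N := Var i)) (t N) = t i"
    and zero: "\<And>N. N \<notin> B \<Longrightarrow> evaluated (subst_tm (Var(N := Zero)) (t N))"
    and step: "\<And>N K. evaluated (h N K)"
    and rec: "\<And>M' e N K. pa_model F M' \<Longrightarrow> N \<notin> B \<Longrightarrow> K \<notin> B \<Longrightarrow> N \<noteq> K \<Longrightarrow>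
      e K = val M' e (t N) \<Longrightarrow> val M' (e(N := sc M' (e N))) (t N) = val M' e (h N K)"
  shows "evaluated (t i)"
  unfolding evaluated_def
proof (intro allI reflectedI)
  fix j \<psi> e
  assume \<psi>: "wf_fm F \<psi>" and *: "sat M e (Equal (t i) (Var j))" "P (dot_val e \<psi>)"
  have fin: "finite (fv \<psi> \<union> B)" using B by simp
  obtain N where "N \<notin> fv \<psi> \<union> B" using ex_fresh[OF fin] by blast
  moreover have fin1: "finite (insert N (fv \<psi> \<union> B))" using fin by simp
  obtain K where "K \<notin> insert N (fv \<psi> \<union> B)" using ex_fresh[OF fin1] by blast
  moreover have fin2: "finite (insert K (insert N (fv \<psi> \<union> B)))" using fin1 by simp
  obtain L where "L \<notin> insert K (insert N (fv \<psi> \<union> B))" using ex_fresh[OF fin2] by blast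
  ultimately have \<psi>_fresh [simp]: "N \<notin> fv \<psi>" "K \<notin> fv \<psi>" "L \<notin> fv \<psi>"
    and B_fresh: "N \<notin> B" "K \<notin> B" "L \<notin> B"
    and neq [simp]: "N \<noteq> K" "N \<noteq> L" "K \<noteq> L" "K \<noteq> N" "L \<noteq> N" "L \<noteq> K" by auto
  have t_fresh [simp]: "K \<notin> fv_tm (t N)" "L \<notin> fv_tm (t N)" using B(2) B_fresh by force+
  have h_fresh [simp]: "L \<notin> fv_tm (h N K)" using B(3) B_fresh by force
  define \<chi> where "\<chi> = Conj \<psi> (Equal (t N) (Var K))"
  have wf_\<chi>: "wf_fm F \<chi>" using \<psi> wf by (simp add: \<chi>_def)
  have \<chi>_fresh: "L \<notin> fv \<chi>" by (simp add: \<chi>_def)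
  \<comment> \<open>The induction claim is that \<open>P\<close> holds of \<open>\<chi>\<close> when
    \<open>N\<close> is \<open>a\<close> and \<open>K\<close> is the value of \<open>t N\<close>
    there.\<close>
  define E where "E a = e(N := a, K := val M (e(N := a)) (t N))" for a
  have EN: "E a N = a" and EK: "E a K = val M (E a) (t N)" for a by (simp_all add: E_def)
  have "P (dot_val (E a) \<chi>)" for a
  proof -
    \<comment> \<open>Expresses this code as a term in the induction variable \<open>Var 0\<close>.
      As the value of \<open>K\<close> depends on that variable, \<open>K\<close> is replaced by the
      term computing it; the parameters are shifted past the induction variable.\<close>
    define \<sigma> where "\<sigma> = (\<lambda>m. if m = N then Var 0 else if m = K
      then subst_tm (\<lambda>m. if m = N then Var 0 else Var (Suc m)) (t N) else Var (Suc m))"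
    have "(\<lambda>m. val M (case_nat a e) (if m = N then Var 0 else Var (Suc m))) = e(N := a)" for a
      by (rule ext) simp
    then have "(\<lambda>m. val M (case_nat a e) (\<sigma> m)) = E a" for a
      by (intro ext) (simp add: \<sigma>_def E_def val_subst)
    then have E: "val M (case_nat a e) (subst_tm \<sigma> (dot_quote \<chi>)) = dot_val (E a) \<chi>" for a
      by (simp add: val_subst dot_val_def)
    have "P (val M (case_nat a e) (subst_tm \<sigma> (dot_quote \<chi>)))"
    proof (rule P_induct; (unfold E)?)
      show "wf_tm F (subst_tm \<sigma> (dot_quote \<chi>))"
        using wf wf_dot_quote[OF admissible] by (auto simp: \<sigma>_def intro!: wf_subst_tm)
    next
      \<comment> \<open>At the start \<open>N\<close> has the value zero, so writing
        \<open>Zero\<close> for it does not change the code, and the term with \<open>Zero\<close>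
        is evaluated by assumption.\<close>
      let ?\<sigma> = "Var(N := Zero)" and ?e = "E (zr M)"
      have "val M ?e (subst_tm ?\<sigma> (t N)) = val M ?e (t N)"
        unfolding val_subst by (rule val_cong) (simp add: EN)
      then have "sat M ?e (Equal (subst_tm ?\<sigma> (t N)) (Var K))" by (simp add: EK)
      moreover have "P (dot_val ?e \<psi>)" using *(2) by (simp add: E_def)
      ultimately have "P (dot_val ?e (Conj \<psi> (Equal (subst_tm ?\<sigma> (t N)) (Var K))))"
        using zero[OF B_fresh(1)] \<psi> by (auto simp: evaluated_def intro: reflectedD)
      then have "P (dot_val ?e (subst ?\<sigma> \<chi>))" by (simp add: \<chi>_def)
      moreover have "dot_val ?e (subst ?\<sigma> \<chi>) = dot_val ?e \<chi>"
        by (rule dot_val_subst) (use EN num_pf_zr in auto)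
      ultimately show "P (dot_val (E (zr M)) \<chi>)" by simp
    next
      fix a assume IH: "P (dot_val (E a) \<chi>)"
      \<comment> \<open>\<open>L\<close> names the next value. The whole induction hypothesis
        \<open>\<chi>\<close> serves as the side formula for the equation that defines it.\<close>
      define c where "c = val M (E a) (h N K)"
      let ?e = "(E a)(L := c)" and ?H = "Equal (h N K) (Var L)"
      let ?\<sigma> = "Var(N := Succ (Var N), K := Var L)"
      have H: "reflected ?H" using step by (simp add: evaluated_def)
      have "P (dot_val ?e \<chi>)" using IH \<chi>_fresh by simp
      moreover have "sat M ?e ?H" by (simp add: c_def)
      ultimately have "P (dot_val ?e (Conj \<chi> ?H))" using reflectedD[OF H wf_\<chi>] by blast
      then have "P (dot_val ?e (subst ?\<sigma> \<chi>))"
      proof (rule P_mono[rotated 3])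
        fix M' e' assume pa: "pa_model F M'" and s: "sat M' e' (Conj \<chi> ?H)"
        have "(\<lambda>i. val M' e' (?\<sigma> i)) = e'(N := sc M' (e' N), K := e' L)" by (rule ext) simp
        then have "sat M' e' (subst ?\<sigma> \<chi>) = sat M' (e'(N := sc M' (e' N), K := e' L)) \<chi>"
          by (simp only: sat_subst)
        moreover have "val M' (e'(N := sc M' (e' N))) (t N) = val M' e' (h N K)"
          using s by (intro rec[OF pa]) (auto simp: B_fresh \<chi>_def)
        ultimately show "sat M' e' (subst ?\<sigma> \<chi>)" using s by (simp add: \<chi>_def)
      qed (use wf_\<chi> reflected_wf[OF H] in \<open>auto intro!: wf_subst\<close>)
      \<comment> \<open>With \<open>Succ (Var N)\<close> in place of \<open>N\<close> and
        \<open>L\<close> in place of \<open>K\<close>, the code is that of \<open>\<chi>\<close> one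
        step further, by \<open>num_pf_sc\<close>.\<close>
      moreover have "dot_val ?e (subst ?\<sigma> \<chi>) = dot_val (E (sc M a)) \<chi>"
      proof (rule dot_val_subst)
        have "val M ((E a)(N := sc M (E a N))) (t N) = c"
          unfolding c_def by (rule rec[OF pa_model_self]) (use B_fresh EK in auto)
        then have "E (sc M a) K = c" by (simp add: E_def fun_upd_twist)
        then show "val M ?e (dot_tm 0 (?\<sigma> i)) = fn M num_pf [E (sc M a) i]" if "i \<in> fv \<chi>" for i
          using that \<chi>_fresh num_pf_sc by (auto simp: E_def)
      qed
      ultimately show "P (dot_val (E (sc M a)) \<chi>)" by simp
    qed
    then show ?thesis by (simp add: E)
  qed
  then have "P (dot_val (E (e i)) \<chi>)" .
  \<comment> \<open>At \<open>a = e i\<close> the auxiliary variables \<open>N\<close> and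
    \<open>K\<close> have the values of \<open>i\<close> and \<open>j\<close>, and codes depend on
    values only.\<close>
  also have "dot_val (E (e i)) \<chi> = dot_val e (subst (Var(N := Var i, K := Var j)) \<chi>)"
  proof (rule dot_val_subst[symmetric])
    have "val M (e(N := e i)) (t N) = val M e (t i)"
      unfolding rename[OF B_fresh(1), of i, symmetric] val_subst by (rule val_cong) simp
    then have "E (e i) K = e j" using *(1) by (simp add: E_def)
    then show "val M e (dot_tm 0 ((Var(N := Var i, K := Var j)) m)) = fn M num_pf [E (e i) m]" for m
      by (simp add: E_def)
  qed
  also have "subst (Var(N := Var i, K := Var j)) \<chi> = Conj \<psi> (Equal (t i) (Var j))"
    by (simp add: \<chi>_def rename B_fresh)
  finally show "P (dot_val e (Conj \<psi> (Equal (t i) (Var j))))" .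
qed (use wf in simp)

lemma evaluated_Add_Var: "evaluated (Add (Var k) (Var i))"
proof (rule evaluated_rec[where B = "{k}" and h = "\<lambda>N K. Succ (Var K)" and t = "\<lambda>i. Add (Var k) (Var i)"])
  fix N assume "N \<notin> {k}"
  then show "evaluated (subst_tm (Var(N := Zero)) (Add (Var k) (Var N)))"
    by (intro evaluated_cong[OF evaluated_Var[of k]]) (auto simp: pa_model.ad_zr)
qed (auto simp: evaluated_Succ_Var pa_model.ad_sc)

lemma evaluated_Mul_Var: "evaluated (Mul (Var k) (Var i))"
proof (rule evaluated_rec[where B = "{k}" and h = "\<lambda>N K. Add (Var K) (Var k)"
      and t = "\<lambda>i. Mul (Var k) (Var i)"])
  fix N assume "N \<notin> {k}"
  then show "evaluated (subst_tm (Var(N := Zero)) (Mul (Var k) (Var N)))"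
    by (intro evaluated_cong[OF evaluated_Zero]) (auto simp: pa_model.ml_zr)
qed (auto simp: evaluated_Add_Var pa_model.ml_sc)

lemma evaluated_Add:
  assumes t: "evaluated t" and u: "evaluated u"
  shows "evaluated (Add t u)"
  unfolding evaluated_def
proof
  fix j
  note wf = evaluated_wf[OF t] evaluated_wf[OF u]
  have 1: "reflected (Equal (Add (Var k) u) (Var j))" for k
  proof (rule reflected_let[OF u])
    fix N assume "N \<notin> fv_tm u" "N \<notin> fv (Equal (Add (Var k) u) (Var j))"
    then show "\<exists>\<phi>'. reflected \<phi>' \<and> (\<forall>M' e. pa_model F M' \<longrightarrow>
        sat M' (e(N := val M' e u)) \<phi>' = sat M' e (Equal (Add (Var k) u) (Var j)))"
      using evaluated_Add_Var[of k N]
      by (intro exI[of _ "Equal (Add (Var k) (Var N)) (Var j)"]) (auto simp: evaluated_def)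
  qed (use wf in simp)
  show "reflected (Equal (Add t u) (Var j))"
  proof (rule reflected_let[OF t])
    fix N assume "N \<notin> fv_tm t" "N \<notin> fv (Equal (Add t u) (Var j))"
    then show "\<exists>\<phi>'. reflected \<phi>' \<and> (\<forall>M' e. pa_model F M' \<longrightarrow>
        sat M' (e(N := val M' e t)) \<phi>' = sat M' e (Equal (Add t u) (Var j)))"
      using 1[of N] by (intro exI[of _ "Equal (Add (Var N) u) (Var j)"]) auto
  qed (use wf in simp)
qed

lemma evaluated_Mul:
  assumes t: "evaluated t" and u: "evaluated u"
  shows "evaluated (Mul t u)"
  unfolding evaluated_def
proof
  fix j
  note wf = evaluated_wf[OF t] evaluated_wf[OF u]
  have 1: "reflected (Equal (Mul (Var k) u) (Var j))" for k
  proof (rule reflected_let[OF u])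
    fix N assume "N \<notin> fv_tm u" "N \<notin> fv (Equal (Mul (Var k) u) (Var j))"
    then show "\<exists>\<phi>'. reflected \<phi>' \<and> (\<forall>M' e. pa_model F M' \<longrightarrow>
        sat M' (e(N := val M' e u)) \<phi>' = sat M' e (Equal (Mul (Var k) u) (Var j)))"
      using evaluated_Mul_Var[of k N]
      by (intro exI[of _ "Equal (Mul (Var k) (Var N)) (Var j)"]) (auto simp: evaluated_def)
  qed (use wf in simp)
  show "reflected (Equal (Mul t u) (Var j))"
  proof (rule reflected_let[OF t])
    fix N assume "N \<notin> fv_tm t" "N \<notin> fv (Equal (Mul t u) (Var j))"
    then show "\<exists>\<phi>'. reflected \<phi>' \<and> (\<forall>M' e. pa_model F M' \<longrightarrow>
        sat M' (e(N := val M' e t)) \<phi>' = sat M' e (Equal (Mul t u) (Var j)))"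
      using 1[of N] by (intro exI[of _ "Equal (Mul (Var N) u) (Var j)"]) auto
  qed (use wf in simp)
qed

text \<open>The first argument that is still a term is named by a fresh variable, which moves it
  into the list \<open>is\<close>; each such move is one use of
  \<open>reflected_let\<close>.\<close>

lemma evaluated_Fn_args:
  assumes f: "f \<in> F" "\<And>is. length is = arity f \<Longrightarrow> evaluated (Fn f (map Var is))"
    and "\<forall>t\<in>set ts. evaluated t" "length is + length ts = arity f"
  shows "evaluated (Fn f (map Var is @ ts))"
  using assms(3,4)
proof (induction ts arbitrary: "is")
  case Nil
  then show ?case using f by simp
next
  case (Cons t ts)
  show ?case
    unfolding evaluated_def
  proof
    fix j
    show "reflected (Equal (Fn f (map Var is @ t # ts)) (Var j))"
    proof (rule reflected_let)
      show "evaluated t" using Cons.prems by simp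
      show "wf_fm F (Equal (Fn f (map Var is @ t # ts)) (Var j))"
        using f(1) Cons.prems evaluated_wf by auto
      fix N assume N: "N \<notin> fv_tm t" "N \<notin> fv (Equal (Fn f (map Var is @ t # ts)) (Var j))"
      have "evaluated (Fn f (map Var (is @ [N]) @ ts))" using Cons.prems by (intro Cons.IH) auto
      then have "reflected (Equal (Fn f (map Var (is @ [N]) @ ts)) (Var j))"
        by (simp add: evaluated_def)
      moreover have "map (\<lambda>i. if i = N then a else e i) is = map e is" for e :: "nat \<Rightarrow> nat" and a
        using N by auto
      ultimately show "\<exists>\<phi>'. reflected \<phi>' \<and> (\<forall>M' e. pa_model F M' \<longrightarrow>
          sat M' (e(N := val M' e t)) \<phi>' = sat M' e (Equal (Fn f (map Var is @ t # ts)) (Var j)))"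
        using N by (intro exI[of _ "Equal (Fn f (map Var (is @ [N]) @ ts)) (Var j)"])
          (auto simp: comp_def cong: map_cong)
    qed
  qed
qed

text \<open>The induction follows the description of the function, whose constituents belong to the
  language. A composition reduces to evaluated arguments, and a recursion is a case of
  \<open>evaluated_rec\<close> with the first argument as recursion variable.\<close>

lemma evaluated_Fn_Var: "f \<in> F \<Longrightarrow> length is = arity f \<Longrightarrow> evaluated (Fn f (map Var is))"
proof (induction f arbitrary: "is")
  case (PZero n)
  then show ?case
    by (intro evaluated_cong[OF evaluated_Zero]) (auto simp: pa_model.fn_PZero)
next
  case PSucc
  then obtain i where "is = [i]" by (auto simp: length_Suc_conv)
  then show ?case using PSucc
    by (intro evaluated_cong[OF evaluated_Succ_Var[of i]]) (auto simp: pa_model.fn_PSucc)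
next
  case (PProj n i)
  then show ?case using wf_pf_in[OF PProj(1)]
    by (intro evaluated_cong[OF evaluated_Var[of "is ! i"]]) (auto simp: pa_model.fn_PProj)
next
  case (PComp n g hs)
  have F: "g \<in> F" "set hs \<subseteq> F" using constituents_in[OF PComp.prems(1)] by auto
  have ar: "length hs = arity g" "\<forall>h\<in>set hs. arity h = n"
    using wf_pf_in[OF PComp.prems(1)] by auto
  have "evaluated (Fn g (map Var [] @ map (\<lambda>h. Fn h (map Var is)) hs))"
    using F ar PComp.prems PComp.IH by (intro evaluated_Fn_args) auto
  then have "evaluated (Fn g (map (\<lambda>h. Fn h (map Var is)) hs))" by simp
  then show ?case
    by (rule evaluated_cong) (use PComp.prems in \<open>auto simp: pa_model.fn_PComp comp_def\<close>)
next
  case (PRec g h)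
  have F: "g \<in> F" "h \<in> F" and ar: "arity h = arity g + 2"
    using constituents_in[OF PRec.prems(1)] wf_pf_in[OF PRec.prems(1)] by auto
  from PRec.prems obtain i ks where "is": "is = i # ks" and len: "length ks = arity g"
    by (auto simp: length_Suc_conv)
  let ?t = "\<lambda>i. Fn (PRec g h) (Var i # map Var ks)"
  have "evaluated (?t i)"
  proof (rule evaluated_rec[where B = "set ks" and t = ?t
        and h = "\<lambda>N K. Fn h (map Var (N # K # ks))"])
    show "evaluated (Fn h (map Var (N # K # ks)))" for N K
      using F ar len by (intro PRec.IH) auto
  next
    fix N assume N: "N \<notin> set ks"
    have "evaluated (Fn g (map Var ks))" using F len by (intro PRec.IH)
    then have "evaluated (Fn (PRec g h) (Zero # map Var ks))"
      by (rule evaluated_cong) (use PRec.prems len in \<open>auto simp: pa_model.fn_PRec_zr\<close>)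
    moreover have "subst_tm (Var(N := Zero)) (?t N) = Fn (PRec g h) (Zero # map Var ks)"
      using N by auto
    ultimately show "evaluated (subst_tm (Var(N := Zero)) (?t N))" by (simp only:)
  next
    fix M' e N K assume pa: "pa_model F M'" and N: "N \<notin> set ks" and eK: "e K = val M' e (?t N)"
    have ks: "map (\<lambda>i. if i = N then a else e i) ks = map e ks" for a using N by auto
    show "val M' (e(N := sc M' (e N))) (?t N) = val M' e (Fn h (map Var (N # K # ks)))"
      using pa_model.fn_PRec_sc[OF pa PRec.prems(1), of "map e ks" "e N"] len eK
      by (simp add: comp_def ks)
  qed (use PRec.prems(1) len in \<open>auto simp: comp_def cong: map_cong\<close>)
  then show ?case using "is" by simp
qed

lemma evaluated_tm: "wf_tm F t \<Longrightarrow> evaluated t"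
proof (induction t)
  case (Fn f ts)
  then have "evaluated (Fn f (map Var [] @ ts))"
    by (intro evaluated_Fn_args) (auto intro: evaluated_Fn_Var)
  then show ?case by simp
qed (auto intro: evaluated_Var evaluated_Zero evaluated_Succ evaluated_Add evaluated_Mul)

section \<open>Equations, inequalities and bounded quantifiers\<close>

lemma reflected_Equal:
  assumes "wf_tm F t" "wf_tm F u"
  shows "reflected (Equal t u)"
proof (rule reflected_let[OF evaluated_tm[OF assms(2)]])
  fix N assume "N \<notin> fv_tm u" "N \<notin> fv (Equal t u)"
  then show "\<exists>\<phi>'. reflected \<phi>' \<and> (\<forall>M' e. pa_model F M' \<longrightarrow>
      sat M' (e(N := val M' e u)) \<phi>' = sat M' e (Equal t u))"
    using evaluated_tm[OF assms(1)]
    by (intro exI[of _ "Equal t (Var N)"]) (auto simp: evaluated_def)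
qed (use assms in simp)

lemma reflected_leq: "wf_tm F t \<Longrightarrow> wf_tm F u \<Longrightarrow> reflected (leq t u)"
  unfolding leq_def by (intro reflected_Exists reflected_Equal) auto

lemma reflected_lt: "wf_tm F t \<Longrightarrow> wf_tm F u \<Longrightarrow> reflected (lt t u)"
  unfolding lt_def by (intro reflected_leq) auto


text \<open>Induction in \<open>M\<close> on the bound. As \<open>\<phi>\<close> may fail above the
  given bound, its truth below \<open>a\<close> has to be an antecedent of the induction formula,
  next to the statement about codes.\<close>

lemma reflected_ball_Var:
  assumes "reflected \<phi>"
  shows "reflected (Forall (Impl (lt (Var 0) (Var (Suc j))) \<phi>))"
proof (rule reflectedI)
  let ?B = "\<lambda>j. Forall (Impl (lt (Var 0) (Var (Suc j))) \<phi>)"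
  fix \<psi> e assume \<psi>: "wf_fm F \<psi>" and *: "sat M e (?B j)" "P (dot_val e \<psi>)"
  \<comment> \<open>The variable bound \<open>N\<close> must not occur in \<open>\<phi>\<close>
    either, or changing the bound would change the matrix.\<close>
  obtain N where "N \<notin> fv (Conj \<psi> (Forall \<phi>))" using ex_fresh[OF finite_fv] by blast
  then have N [simp]: "N \<notin> fv \<psi>" and N\<phi>: "Suc N \<notin> fv \<phi>" by auto
  define \<chi> where "\<chi> = Conj \<psi> (?B N)"
  have wf_\<chi>: "wf_fm F \<chi>" using \<psi> reflected_wf[OF assms] by (simp add: \<chi>_def)
  have \<phi>_fresh: "sat M' (case_nat x (e'(N := a))) \<phi> = sat M' (case_nat x e') \<phi>" for M' x e' a
    using N\<phi> by (intro sat_cong) (auto split: nat.split)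
  have sat_\<chi>: "sat M' (e'(N := a)) \<chi> \<longleftrightarrow> sat M' e' \<psi> \<and>
      (\<forall>x. pa_model.le M' (sc M' x) a \<longrightarrow> sat M' (case_nat x e') \<phi>)" if "pa_model F M'" for M' e' a
    using that by (simp add: \<chi>_def pa_model.sat_lt \<phi>_fresh)
  have "(\<forall>x. le (sc M x) a \<longrightarrow> sat M (case_nat x e) \<phi>) \<longrightarrow> P (dot_val (e(N := a)) \<chi>)" for a
  proof -
    define \<tau> where "\<tau> = subst_tm (\<lambda>m. if m = N then Var 0 else Var (Suc m)) (dot_quote \<chi>)"
    \<comment> \<open>Inside the quantifier index 0 is the element below the bound and index 1 the
      induction variable; hence the other variables of \<open>\<phi>\<close> are shifted by one more
      than usual.\<close>
    define \<theta> where "\<theta> = Impl (Forall (Impl (lt (Var 0) (Var 1))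
      (subst (case_nat (Var 0) (\<lambda>i. Var (Suc (Suc i)))) \<phi>))) (inst \<Phi> \<tau>)"
    have "(\<lambda>m. val M (case_nat a e) (if m = N then Var 0 else Var (Suc m))) = e(N := a)" for a
      by (rule ext) simp
    then have \<tau>: "val M (case_nat a e) \<tau> = dot_val (e(N := a)) \<chi>" for a
      by (simp add: \<tau>_def val_subst dot_val_def)
    have "(\<lambda>i. val M (case_nat x (case_nat a e)) (case_nat (Var 0) (\<lambda>i. Var (Suc (Suc i))) i)) =
        case_nat x e" for x a
      by (rule ext) (simp split: nat.split)
    then have \<theta>: "sat M (case_nat a e) \<theta> \<longleftrightarrow>
        ((\<forall>x. le (sc M x) a \<longrightarrow> sat M (case_nat x e) \<phi>) \<longrightarrow> P (dot_val (e(N := a)) \<chi>))" for a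
      by (simp add: \<theta>_def sat_lt sat_subst sat_inst \<tau> P_iff[symmetric])
    have "sat M (case_nat a e) \<theta>"
    proof (rule pa_induct)
      have "wf_tm F \<tau>" unfolding \<tau>_def by (rule wf_subst_tm) (auto simp: wf_dot_quote[OF admissible])
      then show "wf_fm F \<theta>"
        unfolding \<theta>_def using wf_\<Phi> reflected_wf[OF assms]
        by (auto intro!: wf_subst split: nat.split)
    next
      let ?\<sigma> = "Var(N := Zero)" and ?e = "e(N := zr M)"
      have "P (dot_val ?e \<psi>)" using *(2) by simp
      then have "P (dot_val ?e (subst ?\<sigma> \<chi>))"
      proof (rule P_mono[rotated 3])
        fix M' e' assume pa: "pa_model F M'" and s: "sat M' e' \<psi>"
        have "(\<lambda>i. val M' e' (?\<sigma> i)) = e'(N := zr M')" by (rule ext) simp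
        then show "sat M' e' (subst ?\<sigma> \<chi>)"
          using s pa_model.not_le_sc_zr[OF pa] by (simp only: sat_subst sat_\<chi>[OF pa]) simp
      qed (use \<psi> wf_\<chi> in \<open>auto intro!: wf_subst\<close>)
      moreover have "dot_val ?e (subst ?\<sigma> \<chi>) = dot_val ?e \<chi>"
        by (rule dot_val_subst) (use num_pf_zr in auto)
      ultimately show "sat M (case_nat (zr M) e) \<theta>" by (simp add: \<theta>)
    next
      fix a assume IH: "sat M (case_nat a e) \<theta>"
      have "P (dot_val (e(N := sc M a)) \<chi>)" if all: "\<forall>x. le (sc M x) (sc M a) \<longrightarrow> sat M (case_nat x e) \<phi>"
      proof -
        \<comment> \<open>The new instance is \<open>\<phi>\<close> at \<open>a\<close>, so variable
          0 and the bound both denote \<open>a\<close>. The equation \<open>?E\<close> records this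
          inside \<open>P\<close>: the old range below \<open>a\<close> and the instance at
          \<open>a\<close> together cover everything below its successor.\<close>
        let ?e = "case_nat a (e(N := a))" and ?E = "Equal (Var 0) (Var (Suc N))"
        let ?\<sigma> = "Var(N := Succ (Var N))"
        have "sat M (case_nat x e) \<phi>" if "le (sc M x) a" for x using all that le_iff[of x a] by simp
        then have "P (dot_val (e(N := a)) \<chi>)" using IH unfolding \<theta> by blast
        then have "P (dot_val ?e (lift \<chi>))" by simp
        then have "P (dot_val ?e (Conj (lift \<chi>) ?E))"
          using wf_\<chi> by (intro reflectedD reflected_Equal) auto
        moreover have "sat M ?e \<phi>" using all le_iff[of a a] by (simp add: \<phi>_fresh)
        ultimately have "P (dot_val ?e (Conj (Conj (lift \<chi>) ?E) \<phi>))"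
          using wf_\<chi> by (intro reflectedD[OF assms]) auto
        then have "P (dot_val ?e (lift (subst ?\<sigma> \<chi>)))"
        proof (rule P_mono[rotated 3])
          fix M' e' assume pa: "pa_model F M'" and s: "sat M' e' (Conj (Conj (lift \<chi>) ?E) \<phi>)"
          define e1 where "e1 = (\<lambda>i. e' (Suc i))"
          have e': "e' = case_nat (e1 N) e1" using s env_split[of e'] by (simp add: e1_def)
          have "sat M' e1 \<chi>" using s by (simp add: sat_liftE e1_def)
          then have "sat M' (e1(N := e1 N)) \<chi>" by (simp only: fun_upd_triv)
          then have 1: "sat M' e1 \<psi>"
            "\<And>x. pa_model.le M' (sc M' x) (e1 N) \<Longrightarrow> sat M' (case_nat x e1) \<phi>"
            unfolding sat_\<chi>[OF pa] by blast+
          have 2: "sat M' (case_nat (e1 N) e1) \<phi>" using s e' by simp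
          have "sat M' (case_nat x e1) \<phi>" if "pa_model.le M' (sc M' x) (sc M' (e1 N))" for x
            using that 1(2)[of x] 2 pa_model.le_iff[OF pa, of x "e1 N"] pa_model.le_sc_sc[OF pa] by auto
          then have "sat M' (e1(N := sc M' (e1 N))) \<chi>"
            unfolding sat_\<chi>[OF pa] using 1(1) by blast
          moreover have "(\<lambda>i. val M' e1 (?\<sigma> i)) = e1(N := sc M' (e1 N))" by (rule ext) simp
          ultimately show "sat M' e' (lift (subst ?\<sigma> \<chi>))"
            unfolding sat_liftE e1_def[symmetric] sat_subst by simp
        qed (use wf_\<chi> reflected_wf[OF assms] in \<open>auto intro!: wf_lift wf_subst\<close>)
        moreover have "dot_val (e(N := a)) (subst ?\<sigma> \<chi>) = dot_val (e(N := sc M a)) \<chi>"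
          by (rule dot_val_subst) (use num_pf_sc in auto)
        ultimately show ?thesis by simp
      qed
      then show "sat M (case_nat (sc M a) e) \<theta>" unfolding \<theta> by blast
    qed
    then show ?thesis unfolding \<theta> .
  qed
  moreover have "\<forall>x. le (sc M x) (e j) \<longrightarrow> sat M (case_nat x e) \<phi>" using *(1) by (simp add: sat_lt)
  ultimately have "P (dot_val (e(N := e j)) \<chi>)" by blast
  also have "dot_val (e(N := e j)) \<chi> = dot_val e (subst (Var(N := Var j)) \<chi>)"
    by (rule dot_val_subst[symmetric]) auto
  finally show "P (dot_val e (Conj \<psi> (?B j)))"
  proof (rule P_mono[rotated 3])
    fix M' e' assume pa: "pa_model F M'" and s: "sat M' e' (subst (Var(N := Var j)) \<chi>)"
    have "(\<lambda>i. val M' e' ((Var(N := Var j)) i)) = e'(N := e' j)" by (rule ext) simp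
    then have "sat M' (e'(N := e' j)) \<chi>" using s by (simp only: sat_subst)
    then show "sat M' e' (Conj \<psi> (?B j))"
      unfolding sat_\<chi>[OF pa] by (simp add: pa_model.sat_lt[OF pa])
  qed (use \<psi> wf_\<chi> reflected_wf[OF assms] in \<open>auto intro!: wf_subst\<close>)
qed (use reflected_wf[OF assms] in simp)

lemma reflected_ball_lt:
  assumes "reflected \<phi>" "wf_tm F t"
  shows "reflected (Forall (Impl (lt (Var 0) (lift_tm t)) \<phi>))"
proof (rule reflected_let[OF evaluated_tm[OF assms(2)]])
  fix N assume "N \<notin> fv (Forall (Impl (lt (Var 0) (lift_tm t)) \<phi>))"
  then have "sat M' (case_nat x (e(N := a))) \<phi> = sat M' (case_nat x e) \<phi>" for M' x e a
    by (intro sat_cong) (auto split: nat.split)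
  then show "\<exists>\<phi>'. reflected \<phi>' \<and> (\<forall>M' e. pa_model F M' \<longrightarrow>
      sat M' (e(N := val M' e t)) \<phi>' = sat M' e (Forall (Impl (lt (Var 0) (lift_tm t)) \<phi>)))"
    using reflected_ball_Var[OF assms(1), of N]
    by (intro exI[of _ "Forall (Impl (lt (Var 0) (Var (Suc N))) \<phi>)"]) (auto simp: pa_model.sat_lt)
qed (use assms reflected_wf in auto)

lemma reflected_ball_leq:
  assumes "reflected \<phi>" "wf_tm F t"
  shows "reflected (Forall (Impl (leq (Var 0) (lift_tm t)) \<phi>))"
proof -
  have "reflected (Forall (Impl (lt (Var 0) (lift_tm (Succ t))) \<phi>))"
    using assms by (intro reflected_ball_lt) auto
  then show ?thesis
    by (rule reflected_equiv)
      (use assms reflected_wf in \<open>auto simp: pa_model.sat_lt pa_model.sat_leq pa_model.le_sc_sc\<close>)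
qed

section \<open>From bounded to \<open>\<Sigma>\<close>1 formulas\<close>

text \<open>The negation is carried along because \<open>Impl\<close> is a primitive connective: its
  left-hand side, and with it every nested implication, needs the negated claim. Bounded quantifiers
  then exchange roles.\<close>

lemma reflected_Delta0:
  "Delta0 \<phi> \<Longrightarrow> wf_fm F \<phi> \<Longrightarrow> reflected \<phi> \<and> reflected (Neg \<phi>)"
proof (induction rule: Delta0.induct)
  case (1 t u)
  then have "reflected (Disj (lt t u) (lt u t))" by (intro reflected_Disj reflected_lt) auto
  then have "reflected (Neg (Equal t u))"
    by (rule reflected_equiv) (use 1 in \<open>auto simp: pa_model.sat_lt pa_model.neq_iff_le\<close>)
  then show ?case using 1 reflected_Equal by simp
next
  case (2 t u)
  then have "reflected (lt u t)" by (intro reflected_lt) auto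
  then have "reflected (Neg (leq t u))"
    by (rule reflected_equiv) (use 2 in \<open>auto simp: pa_model.sat_lt pa_model.sat_leq pa_model.not_le_iff\<close>)
  then show ?case using 2 reflected_leq by simp
next
  case (3 t u)
  then have "reflected (leq u t)" by (intro reflected_leq) auto
  then have "reflected (Neg (lt t u))"
    by (rule reflected_equiv)
      (use 3 in \<open>auto simp: pa_model.sat_lt pa_model.sat_leq pa_model.not_le_iff[symmetric]\<close>)
  then show ?case using 3 reflected_lt by simp
next
  case 4
  \<comment> \<open>Vacuous, since \<open>Falsum\<close> is never true in \<open>M\<close>.\<close>
  have "reflected Falsum" by (rule reflectedI) auto
  moreover have "reflected (Equal Zero Zero)" by (intro reflected_Equal) auto
  then have "reflected (Neg Falsum)" by (rule reflected_equiv) auto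
  ultimately show ?case by simp
next
  case (5 \<phi> \<psi>)
  then have "reflected (Disj (Neg \<phi>) (Neg \<psi>))" by (intro reflected_Disj) auto
  then have "reflected (Neg (Conj \<phi> \<psi>))" by (rule reflected_equiv) (use 5 in auto)
  then show ?case using 5 reflected_Conj by simp
next
  case (6 \<phi> \<psi>)
  then have "reflected (Conj (Neg \<phi>) (Neg \<psi>))" by (intro reflected_Conj) auto
  then have "reflected (Neg (Disj \<phi> \<psi>))" by (rule reflected_equiv) (use 6 in auto)
  then show ?case using 6 reflected_Disj by simp
next
  case (7 \<phi> \<psi>)
  then have "reflected (Conj \<phi> (Neg \<psi>))" by (intro reflected_Conj) auto
  then have neg: "reflected (Neg (Impl \<phi> \<psi>))" by (rule reflected_equiv) (use 7 in auto)
  from 7 have "reflected (Disj (Neg \<phi>) \<psi>)" by (intro reflected_Disj) auto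
  then have "reflected (Impl \<phi> \<psi>)" by (rule reflected_equiv) (use 7 in auto)
  then show ?case using neg by simp
next
  case (8 \<phi> t)
  then have "reflected (Exists (Conj (leq (Var 0) (lift_tm t)) (Neg \<phi>)))"
    by (intro reflected_Exists reflected_Conj reflected_leq) auto
  then have "reflected (Neg (Forall (Impl (leq (Var 0) (lift_tm t)) \<phi>)))"
    by (rule reflected_equiv) (use 8 in auto)
  then show ?case using 8 reflected_ball_leq by simp
next
  case (9 \<phi> t)
  then have "reflected (Exists (Conj (lt (Var 0) (lift_tm t)) (Neg \<phi>)))"
    by (intro reflected_Exists reflected_Conj reflected_lt) auto
  then have "reflected (Neg (Forall (Impl (lt (Var 0) (lift_tm t)) \<phi>)))"
    by (rule reflected_equiv) (use 9 in auto)
  then show ?case using 9 reflected_ball_lt by simp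
next
  case (10 \<phi> t)
  then have "reflected (Forall (Impl (leq (Var 0) (lift_tm t)) (Neg \<phi>)))"
    by (intro reflected_ball_leq) auto
  then have "reflected (Neg (Exists (Conj (leq (Var 0) (lift_tm t)) \<phi>)))"
    by (rule reflected_equiv) (use 10 in auto)
  then show ?case using 10 by (simp add: reflected_Exists reflected_Conj reflected_leq)
next
  case (11 \<phi> t)
  then have "reflected (Forall (Impl (lt (Var 0) (lift_tm t)) (Neg \<phi>)))"
    by (intro reflected_ball_lt) auto
  then have "reflected (Neg (Exists (Conj (lt (Var 0) (lift_tm t)) \<phi>)))"
    by (rule reflected_equiv) (use 11 in auto)
  then show ?case using 11 by (simp add: reflected_Exists reflected_Conj reflected_lt)
qed

lemma reflected_Sigma1: "Sigma1 \<phi> \<Longrightarrow> wf_fm F \<phi> \<Longrightarrow> reflected \<phi>"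
proof (induction rule: Sigma1.induct)
  case (1 \<phi>)
  then show ?case using reflected_Delta0 by blast
next
  case (2 \<phi>)
  then show ?case using reflected_Exists by simp
qed

end

section \<open>The derivability conditions read in a model\<close>

theorem theorem2p20:
  fixes F :: "pfun set" and S T :: "fm set" and \<Phi> :: fm
  assumes "admissible F"
    and "is_theory F S" and "recursively_axiomatized S" and "consistent F S" and "extends F S (PA F)"
    and "is_theory F T" and "recursively_axiomatized T" and "consistent F T" and "extends F T (PA F)"
    and "extends F T S"
    and "wf_fm F \<Phi>" and "fv \<Phi> = {0}"
    and "D1 F S T \<Phi>"
    and "B2U F S T \<Phi>"
  shows "Sigma1_CU F S \<Phi>"
  unfolding Sigma1_CU_def
proof (intro allI impI)
  fix n \<phi> assume \<phi>: "wf_fm F \<phi>" "Sigma1 \<phi>" "fv \<phi> \<subseteq> {..<n}"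
  have pa: "pa_model F M" if "extends F R (PA F)" "models M R" for M R
    using models_PA[OF assms(1) that] assms(1) by unfold_locales
  have sat_\<Phi>: "sat M (case_nat a e) \<Phi> = sat M (case_nat a e') \<Phi>" for M a e e'
    using assms(12) by (intro sat_cong) simp
  show "deriv F S (alls n (Impl \<phi> (inst \<Phi> (dot_quote \<phi>))))"
  proof (rule completeness[OF assms(2,5)])
    fix M e assume M: "models M S"
    interpret pa_model F M using M assms(5) by (rule pa[rotated])
    \<comment> \<open>The choice of \<open>e\<close> is immaterial, as only variable 0 is free in
      \<open>\<Phi>\<close>.\<close>
    define P where "P a \<longleftrightarrow> sat M (case_nat a e) \<Phi>" for a
    have P: "sat M e' (inst \<Phi> (dot_quote \<psi>)) \<longleftrightarrow> P (dot_val e' \<psi>)" for e' \<psi>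
      using sat_\<Phi> unfolding P_def sat_inst dot_val_def by blast
    interpret reflection F M \<Phi> P
    proof unfold_locales
      show "P a \<longleftrightarrow> sat M (case_nat a e') \<Phi>" for a e' unfolding P_def by (rule sat_\<Phi>)
    next
      fix \<psi> \<psi>' e' assume wf: "wf_fm F \<psi>" "wf_fm F \<psi>'" and "P (dot_val e' \<psi>)"
        and mono: "\<And>M' e'. pa_model F M' \<Longrightarrow> sat M' e' \<psi> \<Longrightarrow> sat M' e' \<psi>'"
      obtain k where k: "fv (Conj \<psi> \<psi>') \<subseteq> {..<k}"
        using finite_fv[of "Conj \<psi> \<psi>'"] unfolding finite_nat_set_iff_bounded by blast
      \<comment> \<open>Every model of \<open>T\<close> is a model of PA, so completeness turns
        \<open>mono\<close> into a derivation in \<open>T\<close>. \<open>B2U\<close> then gives a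
        theorem of \<open>S\<close>, whose universal prefix can be instantiated in \<open>M\<close>
        by the arbitrary elements of \<open>e'\<close>.\<close>
      have "deriv F T (alls k (Impl \<psi> \<psi>'))"
        by (rule completeness[OF assms(6,9)]) (use wf k mono pa[OF assms(9)] in auto)
      then have "deriv F S (alls k (Impl (inst \<Phi> (dot_quote \<psi>)) (inst \<Phi> (dot_quote \<psi>'))))"
        using assms(14) wf k unfolding B2U_def by simp
      then have "\<forall>e. sat M e (alls k (Impl (inst \<Phi> (dot_quote \<psi>)) (inst \<Phi> (dot_quote \<psi>'))))"
        using models_deriv[OF M] by blast
      then have "sat M e' (Impl (inst \<Phi> (dot_quote \<psi>)) (inst \<Phi> (dot_quote \<psi>')))"
        unfolding all_sat_alls by blast
      with \<open>P (dot_val e' \<psi>)\<close> show "P (dot_val e' \<psi>')" by (simp add: P)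
    qed (rule assms(11))
    let ?top = "Neg Falsum"
    have "deriv F T ?top" by (rule deriv.ImplI[OF deriv.Assm]) auto
    then have "deriv F S (inst \<Phi> (quote ?top))" using assms(13) unfolding D1_def by simp
    then have "sat M e (inst \<Phi> (quote ?top))" by (rule models_deriv[OF M])
    then have top: "P (dot_val e ?top)" by (simp add: sat_inst P_def dot_val_sentence)
    \<comment> \<open>With the tautology as side formula, reflection yields the conjunction, and
      monotonicity drops the tautology again.\<close>
    have "P (dot_val e \<phi>)" if "sat M e \<phi>"
    proof -
      have "P (dot_val e (Conj ?top \<phi>))"
        using top that by (intro reflectedD reflected_Sigma1 \<phi>) auto
      then show ?thesis by (rule P_mono[rotated 3]) (use \<phi> in auto)
    qed
    then show "sat M e (Impl \<phi> (inst \<Phi> (dot_quote \<phi>)))" by (simp add: P)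
  next
    show "wf_fm F (Impl \<phi> (inst \<Phi> (dot_quote \<phi>)))" using \<phi> assms(1,11) by (simp add: wf_dot_quote)
  next
    show "fv (Impl \<phi> (inst \<Phi> (dot_quote \<phi>))) \<subseteq> {..<n}"
      using \<phi>(3) fv_inst[of \<Phi> "dot_quote \<phi>"] fv_dot_fm[of 0 \<phi>] assms(12)
      by (auto simp: dot_quote_def)
  qed
qed

end
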